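(* Let $q$ be a power of $2$, let $n\ge1$, and let $g$ be a real element of $\mathrm{U}(n,\mathbb{F}_q)$. Suppose that at least one of the following holds: (a) every elementary divisor of $g$ of the form $(t-1)^{2m+1}$ with $m\ge 1$ has even multiplicity; or (b) $g$ has $t-1$ as an elementary divisor with positive multiplicity, and every elementary divisor of $g$ of the form $(t-1)^{2m+1}$ with $m\ge 2$ has even multiplicity. Then $g$ is strongly real in $\mathrm{U}(n,\mathbb{F}_q)$.
   Context: For a prime power $q$ write $\bar a=a^q$ for $a\in\mathbb{F}_{q^2}$, and apply the bar entrywise to matrices. The finite unitary group is $\mathrm{U}(n,\mathbb{F}_q)=\{g\in \mathrm{GL}(n,\mathbb{F}_{q^2}) : {}^{\top}\bar g\, g=I_n\}$; up to isomorphism it is the isometry group of any non-degenerate Hermitian form on an $n$-dimensional $\mathbb{F}_{q^2}$-vector space. An element $g$ of a group $G$ is real in $G$ if it is conjugate in $G$ to $g^{-1}$; it is strongly real in $G$ if there is $s\in G$ with $s^2=1$ and $sgs=g^{-1}$. The multiplicity of $(t-1)^k$ as an elementary divisor of $g$ is the number of Jordan blocks of $g$ of size $k$ with eigenvalue $1$ (multiplicity $0$ is even). *)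

theory Defs
  imports
    "Jordan_Normal_Form.Jordan_Normal_Form_Existence"
    "Jordan_Normal_Form.Jordan_Normal_Form_Uniqueness"
    "Jordan_Normal_Form.DL_Rank"
    "HOL-Algebra.Algebraic_Closure_Type"
    "HOL-Number_Theory.Residues"
    "HOL-Library.Cardinality"
begin

definition real_element :: "('g, 'm) monoid_scheme \<Rightarrow> 'g \<Rightarrow> bool" where
  "real_element G g \<longleftrightarrow> g \<in> carrier G \<and>
     (\<exists>x\<in>carrier G. x \<otimes>\<^bsub>G\<^esub> g \<otimes>\<^bsub>G\<^esub> inv\<^bsub>G\<^esub> x = inv\<^bsub>G\<^esub> g)"

definition strongly_real_element :: "('g, 'm) monoid_scheme \<Rightarrow> 'g \<Rightarrow> bool" where
  "strongly_real_element G g \<longleftrightarrow> g \<in> carrier G \<and>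
     (\<exists>s\<in>carrier G. s \<otimes>\<^bsub>G\<^esub> s = \<one>\<^bsub>G\<^esub> \<and> s \<otimes>\<^bsub>G\<^esub> g \<otimes>\<^bsub>G\<^esub> s = inv\<^bsub>G\<^esub> g)"

definition mat_bar :: "nat \<Rightarrow> 'a :: monoid_mult mat \<Rightarrow> 'a mat" where
  "mat_bar q A = map_mat (\<lambda>a. a ^ q) A"

text \<open>
  The type \<^typ>\<open>'a\<close> plays the role of the field with \<open>q\<^sup>2\<close> elements; the
  equation \<open>CARD('a) = q\<^sup>2\<close> is not part of the definition and has to be assumed wherever
  the unitary group is used, see \<open>group_unitary_group\<close>.
\<close>
definition unitary_group :: "'a :: finite_field itself \<Rightarrow> nat \<Rightarrow> nat \<Rightarrow> 'a mat monoid" where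
  "unitary_group _ n q =
     \<lparr>carrier = {g \<in> carrier_mat n n. invertible_mat g \<and> transpose_mat (mat_bar q g) * g = 1\<^sub>m n},
      monoid.mult = (*), one = 1\<^sub>m n\<rparr>"

text \<open>
  The number of Jordan blocks of \<open>A\<close> of size \<open>k\<close> with eigenvalue \<open>a\<close>, that is, the
  multiplicity of \<open>(t - a)\<^sup>k\<close> as an elementary divisor of \<open>A\<close>. The Jordan form is
  taken over the algebraic closure of the field, since \<open>A\<close> need not have one over the field
  itself. For square \<open>A\<close> it exists, and the count does not depend on which Jordan form is
  chosen; see \<open>jordan_nf_exists_alg_closed\<close> and \<open>elementary_divisor_mult_eq\<close>.
\<close>
definition elementary_divisor_mult :: "'a :: field mat \<Rightarrow> 'a \<Rightarrow> nat \<Rightarrow> nat" where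
  "elementary_divisor_mult A a k =
     count_list (SOME n_as. jordan_nf (map_mat to_ac A) n_as) (k, to_ac a)"


lemma upper_triangular_exists_alg_closed:
  fixes A :: "'a :: alg_closed_field mat"
  assumes "A \<in> carrier_mat n n"
  shows "\<exists>B\<in>carrier_mat n n. upper_triangular B \<and> similar_mat A B"
  using assms
proof (induction n arbitrary: A)
  case 0
  then show ?case
    by (intro bexI[of _ A] conjI) (auto intro: similar_mat_refl)
next
  case (Suc n)
  let ?N = "Suc n"
  note A = Suc.prems
  have "Polynomial.degree (char_poly A) > 0"
    using degree_monic_char_poly[OF A] by simp
  then obtain e where "poly (char_poly A) e = 0"
    using alg_closed_imp_poly_has_root by blast
  then have "eigenvalue A e"
    using eigenvalue_root_char_poly[OF A] by simp
  then obtain v where v: "v \<in> carrier_vec ?N" "v \<noteq> 0\<^sub>v ?N" "A *\<^sub>v v = e \<cdot>\<^sub>v v"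
    using A by (auto simp: eigenvalue_def eigenvector_def)
  interpret V: vec_space "TYPE('a)" ?N .
  define b where "b = basis_completion v"
  note bc = V.basis_completion[OF v(1,2), folded b_def]
  define P where "P = mat_of_cols ?N b"
  have P: "P \<in> carrier_mat ?N ?N"
    unfolding P_def using bc(6) mat_of_cols_carrier(1)[of ?N b] by simp
  have colsP: "cols P = b"
    unfolding P_def using bc(2) by (simp add: cols_mat_of_cols)
  have "V.rank P = ?N"
    by (rule V.lin_indpt_full_rank[OF P]) (use bc(4,5) colsP in auto)
  then have "det P \<noteq> 0"
    using V.det_rank_iff[OF P] by simp
  from det_non_zero_imp_unit[OF P this, of "()"] obtain Q where
    Q: "Q \<in> carrier_mat ?N ?N" and QP: "Q * P = 1\<^sub>m ?N" and PQ: "P * Q = 1\<^sub>m ?N"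
    unfolding Units_def by (auto simp: ring_mat_def)
  have b0: "b ! 0 = v" "length b = ?N"
    using bc(6,7) hd_conv_nth[of b] by (cases b; simp)+
  have col0: "col P 0 = v"
    unfolding P_def using b0 v(1) bc(2) by (subst col_mat_of_cols) auto
  define B where "B = Q * A * P"
  have B: "B \<in> carrier_mat ?N ?N"
    unfolding B_def using Q A P by auto
  have QA: "Q * A \<in> carrier_mat ?N ?N" and PQA: "P * (Q * A) \<in> carrier_mat ?N ?N"
    using P Q A by auto
  have "P * B * Q = (P * Q) * A * (P * Q)"
    unfolding B_def assoc_mult_mat[OF P QA P, symmetric] assoc_mult_mat[OF PQA P Q]
      assoc_mult_mat[OF P Q A] ..
  then have AB: "A = P * B * Q"
    unfolding PQ using A by simp
  have simAB: "similar_mat A B"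
    by (rule similar_matI[of _ _ P Q ?N]) (use A B P Q PQ QP AB in auto)
  have Qv: "Q *\<^sub>v v = unit_vec ?N 0"
  proof -
    have "Q *\<^sub>v v = col (Q * P) 0"
      using col0 P Q by (subst col_mult2[OF Q P]) auto
    then show ?thesis by (simp add: QP)
  qed
  have "col B 0 = (Q * A) *\<^sub>v v"
    unfolding B_def using col0 by (subst col_mult2[of _ ?N ?N]) (use P Q A in auto)
  also have "\<dots> = Q *\<^sub>v (e \<cdot>\<^sub>v v)"
    using v Q A by (simp add: assoc_mult_mat_vec[where ?n\<^sub>2.0 = ?N])
  also have "\<dots> = e \<cdot>\<^sub>v unit_vec ?N 0"
    using Qv mult_mat_vec[OF Q v(1)] by simp
  finally have colB: "col B 0 = e \<cdot>\<^sub>v unit_vec ?N 0" .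
  obtain B1 B2 B3 B4 where sp: "split_block B 1 1 = (B1, B2, B3, B4)"
    by (cases "split_block B 1 1") auto
  have dims: "dim_row B = 1 + n" "dim_col B = 1 + n" using B by auto
  note sb = split_block[OF sp dims]
  have B3: "B3 = 0\<^sub>m n 1"
  proof (rule eq_matI)
    fix i j assume ij: "i < dim_row (0\<^sub>m n 1 :: 'a mat)" "j < dim_col (0\<^sub>m n 1 :: 'a mat)"
    then have "B3 $$ (i, j) = B $$ (Suc i, 0)"
      using sp dims unfolding split_block_def Let_def by auto
    also have "\<dots> = col B 0 $ Suc i"
      using ij B by simp
    also have "\<dots> = 0"
      using ij unfolding colB by simp
    finally show "B3 $$ (i, j) = 0\<^sub>m n 1 $$ (i, j)"
      using ij by simp
  qed (use sb(3) in auto)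
  from Suc.IH[OF sb(4)] obtain C where
    C: "C \<in> carrier_mat n n" "upper_triangular C" "similar_mat B4 C" by blast
  from similar_mat_four_block_0_ex[OF similar_mat_refl[OF sb(1)] C(3) sb(2) sb(1) sb(4)]
  obtain B0 where B0: "B0 \<in> carrier_mat 1 n"
    "similar_mat (four_block_mat B1 B2 (0\<^sub>m n 1) B4) (four_block_mat B1 B0 (0\<^sub>m n 1) C)"
    by blast
  let ?D = "four_block_mat B1 B0 (0\<^sub>m n 1) C"
  have "similar_mat A ?D"
    using similar_mat_trans[OF simAB] B0(2) sb(5) B3 by simp
  moreover have "upper_triangular ?D"
    by (rule upper_triangular_four_block[OF sb(1) C(1) _ C(2)]) (use sb(1) in auto)
  moreover have "?D \<in> carrier_mat ?N ?N"
    using four_block_carrier_mat[OF sb(1) C(1)] by simp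
  ultimately show ?case by blast
qed

lemma jordan_nf_exists_alg_closed:
  fixes A :: "'a :: alg_closed_field mat"
  assumes "A \<in> carrier_mat n n"
  shows "\<exists>n_as. jordan_nf A n_as"
proof -
  from upper_triangular_exists_alg_closed[OF assms] obtain B where
    B: "B \<in> carrier_mat n n" "upper_triangular B" "similar_mat A B" by blast
  from triangular_to_jnf_vector[OF B(1,2)] similar_mat_trans[OF B(3)] show ?thesis
    unfolding jordan_nf_def by blast
qed

lemma jordan_nf_count_unique:
  fixes A :: "'a :: field mat"
  assumes "jordan_nf A n_as" "jordan_nf A m_bs"
  shows "count_list n_as x = count_list m_bs x"
proof -
  obtain k a where x: "x = (k, a)" by (cases x)
  have c: "count_list xs y = length (filter ((=) y) xs)" for xs :: "(nat \<times> 'a) list" and y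
    by (induction xs) auto
  show ?thesis
  proof (cases "k = 0")
    case True
    then have "x \<notin> set n_as" "x \<notin> set m_bs"
      using assms unfolding jordan_nf_def x by force+
    then show ?thesis by simp
  next
    case False
    show ?thesis
      unfolding c x using compute_nr_of_jordan_blocks[OF assms(1) False, of a]
        compute_nr_of_jordan_blocks[OF assms(2) False, of a] by simp
  qed
qed

lemma elementary_divisor_mult_eq:
  fixes A :: "'a :: field mat"
  assumes "jordan_nf (map_mat to_ac A) n_as"
  shows "elementary_divisor_mult A a k = count_list n_as (k, to_ac a)"
  unfolding elementary_divisor_mult_def
  by (rule jordan_nf_count_unique[OF someI[of "jordan_nf (map_mat to_ac A)"] assms]) (rule assms)

lemma group_unitary_group:
  fixes p q e n :: nat
  assumes "Factorial_Ring.prime p" and "q = p ^ e" and card: "CARD('a) = q\<^sup>2"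
  shows "group (unitary_group TYPE('a :: finite_field) n q)"
proof -
  have "CHAR('a) dvd p ^ (e * 2)"
    using CHAR_dvd_CARD[where 'a = 'a] assms by (simp add: power_mult)
  then have char: "CHAR('a) = p"
    using assms(1) CHAR_prime[where 'a = 'a] prime_dvd_power primes_dvd_imp_eq by blast
  have q0: "q > 0"
    using assms(1,2) prime_gt_0_nat by simp
  interpret bar: semiring_hom "\<lambda>a :: 'a. a ^ q"
    by unfold_locales
       (use q0 freshmans_dream'[of q e, where 'a = 'a] assms(1,2) char in
         \<open>auto simp: power_mult_distrib\<close>)
  have bar_bar: "(a ^ q) ^ q = a" for a :: 'a
    using finite_field_power_card_eq_same[of a] card by (simp add: power2_eq_square power_mult)
  let ?H = "\<lambda>g :: 'a mat. transpose_mat (mat_bar q g)"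
  have H: "?H g \<in> carrier_mat n n" if "g \<in> carrier_mat n n" for g
    using that by (auto simp: mat_bar_def)
  have inv: "invertible_mat g" if "g \<in> carrier_mat n n" "?H g * g = 1\<^sub>m n" for g
    using that H[OF that(1)] mat_mult_left_right_inverse[OF H[OF that(1)] that]
    unfolding invertible_mat_def inverts_mat_def square_mat.simps by auto
  have assoc4: "A * B * (C * D) = A * (B * C) * D"
    if "A \<in> carrier_mat n n" "B \<in> carrier_mat n n" "C \<in> carrier_mat n n" "D \<in> carrier_mat n n"
    for A B C D :: "'a mat"
  proof -
    have "A * B * (C * D) = A * (B * (C * D))"
      by (rule assoc_mult_mat[OF that(1,2)]) (use that in auto)
    also have "B * (C * D) = (B * C) * D"
      by (rule assoc_mult_mat[symmetric]) (use that in auto)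
    also have "A * (B * C * D) = A * (B * C) * D"
      by (rule assoc_mult_mat[symmetric]) (use that in auto)
    finally show ?thesis .
  qed
  show ?thesis
  proof (rule groupI)
    fix g h assume g: "g \<in> carrier (unitary_group TYPE('a) n q)"
      and h: "h \<in> carrier (unitary_group TYPE('a) n q)"
    then have g': "g \<in> carrier_mat n n" "?H g * g = 1\<^sub>m n"
      and h': "h \<in> carrier_mat n n" "?H h * h = 1\<^sub>m n"
      by (auto simp: unitary_group_def)
    have "?H (g * h) = ?H h * ?H g"
      using g'(1) h'(1) unfolding mat_bar_def
      by (subst bar.mat_hom_mult[OF g'(1) h'(1)], subst transpose_mult[of _ n n _ n]) auto
    then have "?H (g * h) * (g * h) = ?H h * (?H g * g) * h"
      using assoc4[OF H[OF h'(1)] H[OF g'(1)] g'(1) h'(1)] by simp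
    also have "\<dots> = 1\<^sub>m n"
      using g' h' H[OF h'(1)] by simp
    finally show "g \<otimes>\<^bsub>unitary_group TYPE('a) n q\<^esub> h \<in> carrier (unitary_group TYPE('a) n q)"
      using g'(1) h'(1) inv[of "g * h"] by (auto simp: unitary_group_def)
  next
    have "?H (1\<^sub>m n) * 1\<^sub>m n = 1\<^sub>m n"
      unfolding mat_bar_def by (subst bar.mat_hom_one) simp
    then show "\<one>\<^bsub>unitary_group TYPE('a) n q\<^esub> \<in> carrier (unitary_group TYPE('a) n q)"
      using inv[of "1\<^sub>m n"] by (auto simp: unitary_group_def)
  next
    fix g assume g: "g \<in> carrier (unitary_group TYPE('a) n q)"
    then have g': "g \<in> carrier_mat n n" "?H g * g = 1\<^sub>m n"
      by (auto simp: unitary_group_def)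
    have "?H (?H g) = g"
      using g'(1) by (intro eq_matI) (auto simp: mat_bar_def bar_bar)
    then have *: "?H (?H g) * ?H g = 1\<^sub>m n"
      using mat_mult_left_right_inverse[OF H[OF g'(1)] g'] by simp
    show "\<exists>h\<in>carrier (unitary_group TYPE('a) n q).
            h \<otimes>\<^bsub>unitary_group TYPE('a) n q\<^esub> g = \<one>\<^bsub>unitary_group TYPE('a) n q\<^esub>"
      using g' H[OF g'(1)] * inv[OF H[OF g'(1)] *]
      by (intro bexI[of _ "?H g"]) (auto simp: unitary_group_def)
  qed (auto simp: unitary_group_def)
qed

end

theory Submission
  imports Defs
begin

text \<open>
  Let $g$ be unitary. It suffices to find involutions $s$ and $t$ with $g = st$ that preserve
  \<^emph>\<open>some\<close> non-degenerate hermitian form: if $H$ and $H'$ are two forms preserved by $g$, then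
  $a = H^{-1}H'$ is self-adjoint for $H$ and commutes with $g$, and in even characteristic such
  an $a$ can be written as $b^* b$ with $b$ commuting with everything that commutes with $a$
  (\<open>selfadjoint_unit_is_norm\<close>). Conjugation by $b$ carries isometries of $H'$ to isometries
  of $H$ and fixes $g$. Being a product of two involutions that are isometries of some form is
  called \<open>isometric_involution_product\<close> below. This property is stable under similarity and direct
  sums, so it may be established on the summands of a normal form of $g$, with forms and
  involutions chosen freely on each summand.

  Split $g$ as $U \oplus B$ with $U$ unipotent and $1 + B$ invertible. The form and the element
  that conjugates $g$ to $g^{-1}$ respect this splitting, so $B$ is real in the isometry group of a
  non-degenerate form.

  On $B$ the conjugating element $x$ is corrected to an involution. Replacing $x$ by an odd power
  makes $c = x^2$ unipotent. Conjugation by $x$ is an involutory automorphism of the commutative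
  algebra generated by $g$ and $c$, and because $1 + g$ is invertible this algebra is an
  Artin-Schreier extension of its fixed ring. Norm equations for unipotent elements are therefore
  solvable, and together with Hilbert's Theorem 90 this yields an involution in the coset of $x$
  (\<open>involution_in_inverting_coset\<close>).

  On $U$ there are explicit models. The basis $e_0, \dots, e_{k-1}$ with the arrows
  $e_{i+1} \mapsto e_i$ taken alternately into two nilpotent maps of square $0$ gives two
  involutions whose product is a single Jordan block. The form that pairs $e_i$ with $e_{k-1-i}$
  is preserved by both involutions if $k$ is even. For odd $k$ it pairs them with each other, and two
  copies of the block admit an invariant form. A single block of size $1$ is the identity. Finally a
  block of size $3$ together with a block of size $1$ has a model that involves an element of trace
  $1$ in the quadratic extension. The hypothesis on the multiplicities says precisely that the
  blocks of $U$ can be grouped in this way.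
\<close>

section \<open>Finite rings with involution in characteristic two\<close>

text \<open>
  The model is the ring of matrices over a field with $q^2$ elements, $q$ even, where the star is the
  adjoint with respect to a hermitian form and \<open>\<theta>\<close> is a scalar matrix of trace $1$.
\<close>
locale finite_char2_star_ring = ring R for R (structure) +
  fixes star :: "'a \<Rightarrow> 'a" and \<theta> :: 'a
  assumes finite_carrier: "finite (carrier R)"
    and add_self: "x \<in> carrier R \<Longrightarrow> x \<oplus> x = \<zero>"
    and star_closed [simp, intro]: "x \<in> carrier R \<Longrightarrow> star x \<in> carrier R"
    and star_add: "\<lbrakk>x \<in> carrier R; y \<in> carrier R\<rbrakk> \<Longrightarrow> star (x \<oplus> y) = star x \<oplus> star y"
    and star_mult: "\<lbrakk>x \<in> carrier R; y \<in> carrier R\<rbrakk> \<Longrightarrow> star (x \<otimes> y) = star y \<otimes> star x"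
    and star_star [simp]: "x \<in> carrier R \<Longrightarrow> star (star x) = x"
    and theta_closed [simp, intro]: "\<theta> \<in> carrier R"
    and theta_central: "x \<in> carrier R \<Longrightarrow> x \<otimes> \<theta> = \<theta> \<otimes> x"
    and star_theta: "star \<theta> = \<one> \<oplus> \<theta>"
begin

lemma add_self_left: "\<lbrakk>x \<in> carrier R; y \<in> carrier R\<rbrakk> \<Longrightarrow> x \<oplus> (x \<oplus> y) = y"
  using add_self by (simp add: a_assoc[symmetric])

lemma star_one [simp]: "star \<one> = \<one>"
  by (metis one_closed r_one l_one star_closed star_mult star_star)

lemma star_pow: "x \<in> carrier R \<Longrightarrow> star (x [^] (k::nat)) = star x [^] k"
proof (induction k)
  case (Suc k)
  then have "star (x [^] Suc k) = star x \<otimes> star x [^] k"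
    by (simp add: star_mult)
  with Suc show ?case
    by (metis nat_pow_Suc2 star_closed)
qed simp

lemma left_commute:
  "\<lbrakk>x \<otimes> y = y \<otimes> x; x \<in> carrier R; y \<in> carrier R; z \<in> carrier R\<rbrakk>
    \<Longrightarrow> x \<otimes> (y \<otimes> z) = y \<otimes> (x \<otimes> z)"
  by (metis m_assoc)

lemma commute_mult:
  "\<lbrakk>x \<otimes> y = y \<otimes> x; x \<otimes> z = z \<otimes> x; x \<in> carrier R; y \<in> carrier R; z \<in> carrier R\<rbrakk>
    \<Longrightarrow> x \<otimes> (y \<otimes> z) = (y \<otimes> z) \<otimes> x"
  by (metis m_assoc m_closed)

lemma commute_add:
  "\<lbrakk>x \<otimes> y = y \<otimes> x; x \<otimes> z = z \<otimes> x; x \<in> carrier R; y \<in> carrier R; z \<in> carrier R\<rbrakk>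
    \<Longrightarrow> x \<otimes> (y \<oplus> z) = (y \<oplus> z) \<otimes> x"
  by (simp add: l_distr r_distr)

lemma commute_inverse:
  assumes "x \<otimes> y = y \<otimes> x" "y \<otimes> y' = \<one>" "y' \<otimes> y = \<one>"
    and "x \<in> carrier R" "y \<in> carrier R" "y' \<in> carrier R"
  shows "x \<otimes> y' = y' \<otimes> x"
proof -
  have "x \<otimes> y' = y' \<otimes> y \<otimes> (x \<otimes> y')"
    using assms by (metis l_one m_closed)
  also have "\<dots> = y' \<otimes> (y \<otimes> x) \<otimes> y'"
    using assms(4-6) by (simp only: m_assoc m_closed)
  also have "y \<otimes> x = x \<otimes> y" using assms(1) by simp
  also have "y' \<otimes> (x \<otimes> y) \<otimes> y' = y' \<otimes> x \<otimes> (y \<otimes> y')"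
    using assms(4-6) by (simp only: m_assoc m_closed)
  also have "\<dots> = y' \<otimes> x"
    using assms by (simp add: m_assoc)
  finally show ?thesis .
qed

lemma commute_star:
  assumes "star x \<otimes> y = y \<otimes> star x" "x \<in> carrier R" "y \<in> carrier R"
  shows "x \<otimes> star y = star y \<otimes> x"
  using assms by (metis star_closed star_mult star_star)

lemma one_add_pow_two_pow:
  assumes "x \<in> carrier R"
  shows "(\<one> \<oplus> x) [^] (2 ^ k :: nat) = \<one> \<oplus> x [^] (2 ^ k :: nat)"
proof (induction k)
  case 0
  then show ?case using assms by simp
next
  case (Suc k)
  have sq: "y [^] (2 ^ Suc k :: nat) = y [^] (2 ^ k :: nat) \<otimes> y [^] (2 ^ k :: nat)"
    if "y \<in> carrier R" for y
    using that by (simp add: nat_pow_mult mult_2)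
  define y where "y = x [^] (2 ^ k :: nat)"
  have y: "y \<in> carrier R" using assms by (simp add: y_def)
  have "(\<one> \<oplus> x) [^] (2 ^ Suc k :: nat) = (\<one> \<oplus> y) \<otimes> (\<one> \<oplus> y)"
    using sq[of "\<one> \<oplus> x"] assms Suc.IH by (simp only: y_def a_closed one_closed)
  also have "\<dots> = \<one> \<oplus> y \<otimes> y"
    using y by (simp add: l_distr r_distr a_assoc add_self_left add_self)
  also have "y \<otimes> y = x [^] (2 ^ Suc k :: nat)"
    unfolding y_def using sq[OF assms] by simp
  finally show ?case .
qed

lemma unipotent_imp_Units:
  assumes "y \<in> carrier R" "y [^] (2 ^ k :: nat) = \<one>"
  shows "y \<in> Units R"
proof -
  have "y \<otimes> y [^] (2 ^ k - 1 :: nat) = y [^] (2 ^ k :: nat)"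
    "y [^] (2 ^ k - 1 :: nat) \<otimes> y = y [^] (2 ^ k :: nat)"
    using assms nat_pow_Suc[of y "2 ^ k - 1"] nat_pow_Suc2[of y "2 ^ k - 1"] by simp_all
  with assms show ?thesis
    unfolding Units_def by (auto intro!: bexI[of _ "y [^] (2 ^ k - 1 :: nat)"])
qed

text \<open>
  Odd powers are harmless below: if $x$ conjugates $g$ to $g^{-1}$, then so does every odd power of $x$, and
  $x^r$ differs from $x$ by a square. So it is enough to deal with unipotent elements.
\<close>
lemma odd_power_unipotent:
  assumes "x \<in> Units R"
  obtains r k :: nat where "odd r" "(x [^] r) [^] (2 ^ k :: nat) = \<one>"
proof -
  interpret U: group "units_of R" by (rule units_group)
  have fin: "finite (Units R)"
    by (rule finite_subset[OF _ finite_carrier]) (auto simp: Units_def)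
  define N where "N = order (units_of R)"
  have "N \<noteq> 0"
    unfolding N_def Coset.order_def using fin assms by (auto simp: units_of_carrier)
  then obtain k r where N: "N = 2 ^ k * r" "\<not> 2 dvd r"
    by (metis multiplicity_decompose' prime_elem_nat_iff two_is_prime_nat not_prime_unit)
  have "x [^]\<^bsub>units_of R\<^esub> N = \<one>\<^bsub>units_of R\<^esub>"
    unfolding N_def using assms by (intro U.pow_order_eq_1) (simp add: units_of_carrier)
  then have "x [^] N = \<one>"
    using assms by (simp add: units_of_pow units_of_one)
  then have "(x [^] r) [^] (2 ^ k :: nat) = \<one>"
    using assms by (simp add: nat_pow_pow N(1) mult.commute Units_closed)
  with N(2) show ?thesis by (intro that) auto
qed

text \<open>
  Writing $v = m + v'$ turns the equation into the same equation for $v'$ with right-hand side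
  $\nu m^2$, whose exponent of nilpotency is halved. The solution obtained in this way is a polynomial
  in $m$ and $\nu$; the last two clauses record the consequences of this that are used.
\<close>
lemma artin_schreier_solution:
  fixes k :: nat
  assumes "m \<in> carrier R" "\<nu> \<in> carrier R" "\<nu> \<otimes> m = m \<otimes> \<nu>" "m [^] (2 ^ k :: nat) = \<zero>"
  shows "\<exists>v\<in>carrier R. v \<oplus> \<nu> \<otimes> (v \<otimes> v) = m
    \<and> (\<forall>y\<in>carrier R. y \<otimes> m = m \<otimes> y \<longrightarrow> y \<otimes> \<nu> = \<nu> \<otimes> y \<longrightarrow> y \<otimes> v = v \<otimes> y)
    \<and> (star m = m \<longrightarrow> star \<nu> = \<nu> \<longrightarrow> star v = v)"
  using assms
proof (induction k arbitrary: m)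
  case 0
  then have "m = \<zero>" by simp
  moreover have "star \<zero> = \<zero>"
    by (metis add_self star_add star_closed zero_closed)
  ultimately show ?case using 0 by (intro bexI[of _ \<zero>]) auto
next
  case (Suc k)
  note c = Suc.prems(1,2)
  define m' where "m' = \<nu> \<otimes> (m \<otimes> m)"
  have m': "m' \<in> carrier R" using c by (simp add: m'_def)
  have cnu: "\<nu> \<otimes> (m \<otimes> m) = (m \<otimes> m) \<otimes> \<nu>"
    by (rule commute_mult) (use Suc.prems in auto)
  have "m' [^] (2 ^ k :: nat) = \<nu> [^] (2 ^ k :: nat) \<otimes> (m \<otimes> m) [^] (2 ^ k :: nat)"
    unfolding m'_def using c cnu by (intro pow_mult_distrib) auto
  also have "(m \<otimes> m) [^] (2 ^ k :: nat) = m [^] (2 ^ Suc k :: nat)"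
    using c by (simp add: pow_mult_distrib nat_pow_mult mult_2)
  finally have nil: "m' [^] (2 ^ k :: nat) = \<zero>"
    using Suc.prems by simp
  have com: "\<nu> \<otimes> m' = m' \<otimes> \<nu>"
    unfolding m'_def by (rule commute_mult) (use c cnu in auto)
  obtain v where v: "v \<in> carrier R" "v \<oplus> \<nu> \<otimes> (v \<otimes> v) = m'"
    and vc: "\<And>y. \<lbrakk>y \<in> carrier R; y \<otimes> m' = m' \<otimes> y; y \<otimes> \<nu> = \<nu> \<otimes> y\<rbrakk> \<Longrightarrow> y \<otimes> v = v \<otimes> y"
    and vs: "\<lbrakk>star m' = m'; star \<nu> = \<nu>\<rbrakk> \<Longrightarrow> star v = v"
    using Suc.IH[OF m' c(2) com nil] by blast
  have ym': "y \<otimes> m' = m' \<otimes> y"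
    if "y \<in> carrier R" "y \<otimes> m = m \<otimes> y" "y \<otimes> \<nu> = \<nu> \<otimes> y" for y
    unfolding m'_def using that c by (intro commute_mult) auto
  have mv: "m \<otimes> v = v \<otimes> m"
    using Suc.prems(3) by (intro vc ym' c(1)) simp_all
  have eq: "(m \<oplus> v) \<oplus> \<nu> \<otimes> ((m \<oplus> v) \<otimes> (m \<oplus> v)) = m"
  proof -
    have "(m \<oplus> v) \<otimes> (m \<oplus> v) = m \<otimes> m \<oplus> v \<otimes> v"
      using c v(1) mv by (simp add: l_distr r_distr a_assoc add_self_left)
    then have "(m \<oplus> v) \<oplus> \<nu> \<otimes> ((m \<oplus> v) \<otimes> (m \<oplus> v)) = m \<oplus> (m' \<oplus> (v \<oplus> \<nu> \<otimes> (v \<otimes> v)))"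
      using c v(1) by (simp add: m'_def r_distr a_ac)
    then show ?thesis using v m' c by (simp add: add_self)
  qed
  have st: "star m' = m'" if "star m = m" "star \<nu> = \<nu>"
    unfolding m'_def using that c cnu by (simp add: star_mult)
  show ?case
    using c v(1) eq vc ym' vs st
    by (intro bexI[of _ "m \<oplus> v"]) (auto simp: l_distr r_distr star_add)
qed

text \<open>
  Some odd power $a^r$ is unipotent, and with $r = 2j + 1$ the elements $a$ and $a^r$ differ by the norm
  of the self-adjoint unit $a^j$. For self-adjoint $v$ commuting with \<open>\<theta>\<close> one has
  $(1 + \theta v)^* (1 + \theta v) = 1 + v + \theta\theta^* v^2$, and the Artin-Schreier equation
  makes this equal to the unipotent element $a^r$.
\<close>
lemma selfadjoint_unit_is_norm:
  assumes a: "a \<in> Units R" and sa: "star a = a"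
  shows "\<exists>b\<in>carrier R. star b \<otimes> b = a \<and> (\<forall>y\<in>carrier R. y \<otimes> a = a \<otimes> y \<longrightarrow> y \<otimes> b = b \<otimes> y)"
proof -
  have ac: "a \<in> carrier R" using a by auto
  obtain r k :: nat where r: "odd r" and rk: "(a [^] r) [^] (2 ^ k :: nat) = \<one>"
    using odd_power_unipotent[OF a] .
  obtain j where j: "r = j + 1 + j"
    using r by (metis oddE mult_2 add.commute add.left_commute)
  define m where "m = \<one> \<oplus> a [^] r"
  define \<nu> where "\<nu> = \<theta> \<otimes> star \<theta>"
  have mc: "m \<in> carrier R" and nc: "\<nu> \<in> carrier R"
    using ac by (auto simp: m_def \<nu>_def)
  have cth: "y \<otimes> star \<theta> = star \<theta> \<otimes> y" if "y \<in> carrier R" for y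
    using that by (simp add: star_theta l_distr r_distr theta_central)
  have cnu: "y \<otimes> \<nu> = \<nu> \<otimes> y" if "y \<in> carrier R" for y
    unfolding \<nu>_def using that theta_central cth by (intro commute_mult) auto
  have nil: "m [^] (2 ^ k :: nat) = \<zero>"
    using ac rk by (simp add: m_def one_add_pow_two_pow add_self)
  have sm: "star m = m" using ac sa by (simp add: m_def star_add star_pow)
  have sn: "star \<nu> = \<nu>" by (simp add: \<nu>_def star_mult)
  obtain v where v: "v \<in> carrier R" "v \<oplus> \<nu> \<otimes> (v \<otimes> v) = m" and sv: "star v = v"
    and vc: "\<And>y. \<lbrakk>y \<in> carrier R; y \<otimes> m = m \<otimes> y\<rbrakk> \<Longrightarrow> y \<otimes> v = v \<otimes> y"
    using artin_schreier_solution[OF mc nc cnu[OF mc, symmetric] nil] sm sn cnu by blast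
  define b' where "b' = \<one> \<oplus> \<theta> \<otimes> v"
  have b'c: "b' \<in> carrier R" using v by (simp add: b'_def)
  have sb': "star b' = \<one> \<oplus> star \<theta> \<otimes> v"
    using v sv cth[OF v(1)] by (simp add: b'_def star_add star_mult)
  have "star b' \<otimes> b' = \<one> \<oplus> (star \<theta> \<otimes> v \<oplus> \<theta> \<otimes> v) \<oplus> (star \<theta> \<otimes> v) \<otimes> (\<theta> \<otimes> v)"
    by (subst sb', subst b'_def) (use v in \<open>simp add: l_distr r_distr a_ac\<close>)
  also have "star \<theta> \<otimes> v \<oplus> \<theta> \<otimes> v = v"
    using v by (simp add: star_theta l_distr a_assoc add_self)
  also have "(star \<theta> \<otimes> v) \<otimes> (\<theta> \<otimes> v) = \<nu> \<otimes> (v \<otimes> v)"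
    unfolding \<nu>_def using v theta_central[OF v(1)] theta_central[of "star \<theta>"]
    by (simp add: m_assoc left_commute[of v \<theta> v] left_commute[of "star \<theta>" \<theta>])
  also have "\<one> \<oplus> v \<oplus> \<nu> \<otimes> (v \<otimes> v) = a [^] r"
    using v nc ac by (simp add: a_assoc) (simp add: m_def add_self_left)
  finally have nb': "star b' \<otimes> b' = a [^] r" .
  define ci where "ci = inv a [^] j"
  have ia: "inv a \<in> carrier R" "a \<otimes> inv a = \<one>" "inv a \<otimes> a = \<one>"
    using a by auto
  have sia: "star (inv a) = inv a"
    using ia sa ac by (metis inv_unique star_closed star_mult star_one)
  have cic: "ci \<in> carrier R" using ia by (simp add: ci_def)
  have sci: "star ci = ci" using ia sia by (simp add: ci_def star_pow)
  have cian: "ci \<otimes> a [^] j = \<one>" "a [^] j \<otimes> ci = \<one>"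
    unfolding ci_def using ia ac by (simp_all flip: pow_mult_distrib)
  have "star (b' \<otimes> ci) \<otimes> (b' \<otimes> ci) = ci \<otimes> (star b' \<otimes> b') \<otimes> ci"
    using b'c cic sci by (simp add: star_mult m_assoc)
  also have "\<dots> = (ci \<otimes> a [^] j) \<otimes> a \<otimes> (a [^] j \<otimes> ci)"
  proof -
    have "a [^] r = a [^] (j + 1) \<otimes> a [^] j"
      using ac by (simp only: j nat_pow_mult)
    also have "a [^] (j + 1) = a [^] j \<otimes> a" by simp
    finally show ?thesis unfolding nb' using ac cic by (simp add: m_assoc)
  qed
  also have "\<dots> = a" using ac cian by simp
  finally have nb: "star (b' \<otimes> ci) \<otimes> (b' \<otimes> ci) = a" .
  have "y \<otimes> (b' \<otimes> ci) = (b' \<otimes> ci) \<otimes> y" if y: "y \<in> carrier R" "y \<otimes> a = a \<otimes> y" for y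
  proof -
    have pw: "y \<otimes> z [^] i = z [^] i \<otimes> y" if "z \<in> carrier R" "y \<otimes> z = z \<otimes> y" for z and i :: nat
      using that y(1) by (induction i) (auto intro!: commute_mult)
    have "y \<otimes> m = m \<otimes> y"
      unfolding m_def using y ac pw[of a r] by (intro commute_add) auto
    from vc[OF y(1) this] have "y \<otimes> b' = b' \<otimes> y"
      unfolding b'_def using y v(1) theta_central[of y] by (intro commute_add commute_mult) auto
    moreover have "y \<otimes> ci = ci \<otimes> y"
      unfolding ci_def
      by (rule pw[OF ia(1) commute_inverse[OF y(2) ia(2,3) y(1) ac ia(1)]])
    ultimately show ?thesis
      using y(1) b'c cic by (intro commute_mult)
  qed
  with nb b'c cic show ?thesis by (intro bexI[of _ "b' \<otimes> ci"]) auto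
qed

text \<open>
  Let $\sigma$ be conjugation by $x$, where $x$ is an odd power of $x_0$ with $c = x^2$ unipotent. The
  element $w = (1 + g)^{-1}$ satisfies $\sigma(w) = 1 + w$, so the norm of $1 + vw$ for $\sigma$-invariant
  $v$ is $1 + v + w(1 + w)v^2$ and every unipotent $\sigma$-invariant element $z$ is a norm
  $\sigma(d)d$. If moreover $z^* = cz$, then $s = x\,d\,(d^*)^{-1}$ is unitary and
  $s^2 = c\,z\,(z^*)^{-1} = 1$. In the proof \<open>d'\<close> and \<open>f'\<close> are the images of \<open>d\<close> and
  \<open>f\<close> $= d^*$ under $\sigma$.
\<close>
lemma involution_in_inverting_coset:
  assumes g: "g \<in> carrier R" "star g \<otimes> g = \<one>" "g \<otimes> star g = \<one>"
    and x0: "x0 \<in> carrier R" "star x0 \<otimes> x0 = \<one>" "x0 \<otimes> star x0 = \<one>"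
    and x0g: "x0 \<otimes> g = star g \<otimes> x0"
    and w: "w \<in> carrier R" "(\<one> \<oplus> g) \<otimes> w = \<one>" "w \<otimes> (\<one> \<oplus> g) = \<one>"
  shows "\<exists>s\<in>carrier R. s \<otimes> s = \<one> \<and> star s \<otimes> s = \<one> \<and> s \<otimes> g = star g \<otimes> s"
proof -
  have sg: "star g \<in> carrier R" using g by simp
  have x0U: "x0 \<in> Units R" using x0 unfolding Units_def by auto
  obtain r k :: nat where r: "odd r" and rk: "(x0 [^] r) [^] (2 ^ k :: nat) = \<one>"
    using odd_power_unipotent[OF x0U] .
  define x where "x = x0 [^] r"
  have x: "x \<in> carrier R" using x0 by (simp add: x_def)
  have sx: "star x \<otimes> x = \<one>" "x \<otimes> star x = \<one>"
  proof -
    have "star x = star x0 [^] r" using x0 by (simp add: x_def star_pow)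
    then show "star x \<otimes> x = \<one>" "x \<otimes> star x = \<one>"
      unfolding x_def using x0 by (simp_all flip: pow_mult_distrib)
  qed
  have x0sg: "x0 \<otimes> star g = g \<otimes> x0"
  proof -
    have "x0 \<otimes> star g = g \<otimes> (star g \<otimes> x0) \<otimes> star g"
      using g x0 by (simp add: m_assoc[symmetric])
    also have "\<dots> = g \<otimes> x0"
      using g x0 by (simp add: x0g[symmetric] m_assoc)
    finally show ?thesis .
  qed
  have xg: "x \<otimes> g = star g \<otimes> x"
  proof -
    obtain i where i: "r = 2 * i + 1" using r by (auto elim!: oddE)
    have "g \<otimes> (x0 \<otimes> x0) = (x0 \<otimes> x0) \<otimes> g"
      using g x0 sg x0g x0sg by (metis m_assoc)
    then have "g \<otimes> (x0 \<otimes> x0) [^] i = (x0 \<otimes> x0) [^] i \<otimes> g"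
      using g x0 by (induction i) (auto intro!: commute_mult)
    moreover have "(x0 \<otimes> x0) [^] i = x0 [^] (2 * i)"
      using x0 by (simp add: pow_mult_distrib nat_pow_mult mult_2)
    ultimately have "g \<otimes> x0 [^] (2 * i) = x0 [^] (2 * i) \<otimes> g" by simp
    moreover have "x = x0 \<otimes> x0 [^] (2 * i)"
      unfolding x_def i using x0 by (metis Suc_eq_plus1 nat_pow_Suc2)
    ultimately show ?thesis
      using g x0 x0g sg by (metis m_assoc nat_pow_closed)
  qed
  define c where "c = x \<otimes> x"
  define ci where "ci = star x \<otimes> star x"
  have c: "c \<in> carrier R" "ci \<in> carrier R" using x by (auto simp: c_def ci_def)
  have sc: "star c = ci" using x by (simp add: c_def ci_def star_mult)
  have cci: "c \<otimes> ci = \<one>" "ci \<otimes> c = \<one>"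
  proof -
    have "c \<otimes> ci = x \<otimes> (x \<otimes> star x) \<otimes> star x"
      unfolding c_def ci_def using x by (simp only: m_assoc m_closed star_closed)
    then show "c \<otimes> ci = \<one>" using sx x by simp
    have "ci \<otimes> c = star x \<otimes> (star x \<otimes> x) \<otimes> x"
      unfolding c_def ci_def using x by (simp only: m_assoc m_closed star_closed)
    then show "ci \<otimes> c = \<one>" using sx x by simp
  qed
  have xsg: "x \<otimes> star g = g \<otimes> x"
  proof -
    have "x \<otimes> star g = g \<otimes> (star g \<otimes> x) \<otimes> star g"
      using g x by (simp add: m_assoc[symmetric])
    also have "\<dots> = g \<otimes> x"
      using g x by (simp add: xg[symmetric] m_assoc)
    finally show ?thesis .
  qed
  have cg: "g \<otimes> c = c \<otimes> g"
    unfolding c_def using g x sg xg xsg by (metis m_assoc)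
  have cx: "x \<otimes> c = c \<otimes> x" unfolding c_def using x by (simp add: m_assoc)
  (* Both sides equal w g, because star g is the inverse of g. *)
  have sw: "star w = \<one> \<oplus> w"
  proof -
    have "star w \<otimes> (\<one> \<oplus> star g) = \<one>"
      using w(2) g w(1) by (metis star_mult star_add star_one one_closed a_closed)
    moreover have "\<one> \<oplus> star g = star g \<otimes> (\<one> \<oplus> g)"
      using g by (simp add: r_distr a_comm)
    ultimately have "star w \<otimes> star g \<otimes> (\<one> \<oplus> g) = \<one>"
      using w g by (simp add: m_assoc)
    then have "star w \<otimes> star g \<otimes> ((\<one> \<oplus> g) \<otimes> w) = w"
      using w(1) g by (simp add: m_assoc[symmetric] del: w)
    then have "star w \<otimes> star g = w" using w g by simp
    then have "star w \<otimes> star g \<otimes> g = w \<otimes> g" by simp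
    then have 1: "star w = w \<otimes> g" using w g by (simp add: m_assoc)
    have "w \<oplus> w \<otimes> g = \<one>" using w g by (simp add: r_distr)
    then have "w \<otimes> g = w \<oplus> \<one>" using w g by (metis add_self_left m_closed)
    then show ?thesis using 1 w by (simp add: a_comm)
  qed
  have xw: "x \<otimes> w = (\<one> \<oplus> w) \<otimes> x"
  proof -
    have "star w \<otimes> (\<one> \<oplus> star g) = \<one>"
      using w(2) g w(1) by (metis star_mult star_add star_one one_closed a_closed)
    then have "x \<otimes> w = star w \<otimes> ((\<one> \<oplus> star g) \<otimes> x) \<otimes> w"
      using x w g by (simp add: m_assoc[symmetric])
    also have "(\<one> \<oplus> star g) \<otimes> x = x \<otimes> (\<one> \<oplus> g)"
      using x g xg by (simp add: l_distr r_distr)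
    also have "star w \<otimes> (x \<otimes> (\<one> \<oplus> g)) \<otimes> w = star w \<otimes> x"
      using x w g by (simp add: m_assoc)
    finally show ?thesis using sw by simp
  qed
  have wx: "w \<otimes> x = x \<otimes> (\<one> \<oplus> w)"
    using xw x w by (simp add: l_distr r_distr add_self_left)
  have wg: "g \<otimes> w = w \<otimes> g"
  proof -
    have "w \<otimes> (\<one> \<oplus> g) = (\<one> \<oplus> g) \<otimes> w" using w by simp
    then have "w \<oplus> w \<otimes> g = w \<oplus> g \<otimes> w" using w(1) g by (simp add: l_distr r_distr)
    then show ?thesis using w(1) g by (metis add_self_left m_closed)
  qed
  have cw: "c \<otimes> w = w \<otimes> c"
    using commute_inverse[of c "\<one> \<oplus> g" w] c g w cg by (simp add: l_distr r_distr)
  define \<nu> where "\<nu> = w \<otimes> (\<one> \<oplus> w)"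
  have nc: "\<nu> \<in> carrier R" using w by (simp add: \<nu>_def)
  have ynu: "y \<otimes> \<nu> = \<nu> \<otimes> y" if "y \<in> carrier R" "y \<otimes> w = w \<otimes> y" for y
    unfolding \<nu>_def using that w by (intro commute_mult commute_add) auto
  have xnu: "x \<otimes> \<nu> = \<nu> \<otimes> x"
  proof -
    have "x \<otimes> \<nu> = (x \<otimes> w) \<otimes> (\<one> \<oplus> w)" using x w by (simp add: \<nu>_def m_assoc)
    also have "\<dots> = (\<one> \<oplus> w) \<otimes> (x \<otimes> (\<one> \<oplus> w))"
      unfolding xw using x w by (simp only: m_assoc m_closed a_closed one_closed)
    also have "\<dots> = (\<one> \<oplus> w) \<otimes> w \<otimes> x"
      unfolding wx[symmetric] using x w by (simp only: m_assoc m_closed a_closed one_closed)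
    also have "(\<one> \<oplus> w) \<otimes> w = \<nu>" using w by (simp add: \<nu>_def l_distr r_distr)
    finally show ?thesis .
  qed
  (* Hilbert's Theorem 90 for the unitary element c: this z is unipotent with star z = c z. *)
  define z where "z = \<theta> \<oplus> ci \<otimes> star \<theta>"
  define m where "m = (\<one> \<oplus> ci) \<otimes> star \<theta>"
  have zc: "z \<in> carrier R" "m \<in> carrier R" using c by (auto simp: z_def m_def)
  have cth: "y \<otimes> star \<theta> = star \<theta> \<otimes> y" if "y \<in> carrier R" for y
    using that by (simp add: star_theta l_distr r_distr theta_central)
  have zm: "z = \<one> \<oplus> m"
  proof -
    have "\<theta> = \<one> \<oplus> star \<theta>" by (simp add: star_theta add_self_left)
    then show ?thesis
      unfolding z_def m_def using c by (metis l_distr l_one a_assoc m_closed one_closed star_closed theta_closed)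
  qed
  have cik: "ci [^] (2 ^ k :: nat) = \<one>"
  proof -
    have "ci [^] (2 ^ k :: nat) = star ((x \<otimes> x) [^] (2 ^ k :: nat))"
      using x c sc by (simp add: star_pow c_def)
    also have "(x \<otimes> x) [^] (2 ^ k :: nat) = \<one>"
      using x rk by (simp add: pow_mult_distrib x_def[symmetric])
    finally show ?thesis by simp
  qed
  have nil: "m [^] (2 ^ k :: nat) = \<zero>"
    unfolding m_def using c cth[of "\<one> \<oplus> ci"] cik
    by (simp add: pow_mult_distrib one_add_pow_two_pow add_self)
  have ym: "y \<otimes> m = m \<otimes> y" if "y \<in> carrier R" "y \<otimes> c = c \<otimes> y" for y
    unfolding m_def
    by (rule commute_mult[OF commute_add cth]; (rule commute_inverse[OF that(2) cci])?)
      (use that c in auto)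
  have num: "\<nu> \<otimes> m = m \<otimes> \<nu>"
    using ym[OF nc] ynu[OF c(1) cw] by simp
  obtain v where v: "v \<in> carrier R" "v \<oplus> \<nu> \<otimes> (v \<otimes> v) = m"
    and vc: "\<And>y. \<lbrakk>y \<in> carrier R; y \<otimes> m = m \<otimes> y; y \<otimes> \<nu> = \<nu> \<otimes> y\<rbrakk> \<Longrightarrow> y \<otimes> v = v \<otimes> y"
    using artin_schreier_solution[OF zc(2) nc num nil] by blast
  have vg: "g \<otimes> v = v \<otimes> g" using vc ym ynu g cg wg by simp
  have vx: "x \<otimes> v = v \<otimes> x" using vc ym xnu x cx by simp
  have vw: "w \<otimes> v = v \<otimes> w" using vc ym ynu w cw by simp
  have vci: "c \<otimes> v = v \<otimes> c" using vc ym ynu c cw by simp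
  (* All of g, x, c, w commute with star v as well, since their stars commute with v. *)
  define u where "u = star v"
  have u: "u \<in> carrier R" using v by (simp add: u_def)
  have ucom: "y \<otimes> u = u \<otimes> y" if "y \<in> carrier R" "star y \<otimes> v = v \<otimes> star y" for y
    unfolding u_def using commute_star[of y v] that v by simp
  have ug: "g \<otimes> u = u \<otimes> g"
    by (rule ucom[OF g(1)]) (use commute_inverse[OF vg[symmetric], of "star g"] g v in simp)
  have ux: "x \<otimes> u = u \<otimes> x"
    by (rule ucom[OF x(1)]) (use commute_inverse[OF vx[symmetric], of "star x"] x sx v in simp)
  have uc: "c \<otimes> u = u \<otimes> c"
    by (rule ucom[OF c(1)]) (use commute_inverse[OF vci[symmetric], of "ci"] c cci sc v in simp)
  have uw: "w \<otimes> u = u \<otimes> w"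
    by (rule ucom[OF w(1)]) (use vw v w sw in \<open>simp add: l_distr r_distr\<close>)
  have uv: "u \<otimes> v = v \<otimes> u"
    by (rule vc[OF u ym ynu]) (use u uc uw in auto)
  define d where "d = \<one> \<oplus> v \<otimes> w"
  define d' where "d' = \<one> \<oplus> v \<otimes> (\<one> \<oplus> w)"
  define f where "f = \<one> \<oplus> u \<otimes> (\<one> \<oplus> w)"
  define f' where "f' = \<one> \<oplus> u \<otimes> w"
  have dc: "d \<in> carrier R" "d' \<in> carrier R" "f \<in> carrier R" "f' \<in> carrier R"
    using v u w by (auto simp: d_def d'_def f_def f'_def)
  have sd: "star d = f" "star d' = f'"
    using v w u sw uw
    by (simp_all add: d_def d'_def f_def f'_def star_add star_mult u_def[symmetric] l_distr r_distr
        a_assoc add_self add_self_left)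
  have dx: "d \<otimes> x = x \<otimes> d'"
  proof -
    have "v \<otimes> w \<otimes> x = v \<otimes> x \<otimes> (\<one> \<oplus> w)" using v w x wx by (simp add: m_assoc)
    also have "\<dots> = x \<otimes> (v \<otimes> (\<one> \<oplus> w))"
      unfolding vx[symmetric] using v w x by (simp add: m_assoc)
    finally show ?thesis unfolding d_def d'_def using v w x by (simp add: l_distr r_distr)
  qed
  have fx: "f \<otimes> x = x \<otimes> f'"
  proof -
    have "u \<otimes> (\<one> \<oplus> w) \<otimes> x = u \<otimes> x \<otimes> w" using u w x xw by (simp add: m_assoc)
    also have "\<dots> = x \<otimes> (u \<otimes> w)"
      unfolding ux[symmetric] using u w x by (simp add: m_assoc)
    finally show ?thesis unfolding f_def f'_def using u w x by (simp add: l_distr r_distr)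
  qed
  have ycd: "y \<otimes> d = d \<otimes> y" "y \<otimes> d' = d' \<otimes> y"
    if "y \<in> carrier R" "y \<otimes> v = v \<otimes> y" "y \<otimes> w = w \<otimes> y" for y
    unfolding d_def d'_def using that v w by (auto intro!: commute_add commute_mult)
  have ycf: "y \<otimes> f = f \<otimes> y" "y \<otimes> f' = f' \<otimes> y"
    if "y \<in> carrier R" "y \<otimes> u = u \<otimes> y" "y \<otimes> w = w \<otimes> y" for y
    unfolding f_def f'_def using that u w by (auto intro!: commute_add commute_mult)
  have vd: "v \<otimes> d = d \<otimes> v" "w \<otimes> d = d \<otimes> w" "u \<otimes> d = d \<otimes> u"
    using ycd(1)[OF v(1)] ycd(1)[OF w(1)] ycd(1)[OF u] v w u vw uw uv by auto
  have d'd: "d' \<otimes> d = z"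
  proof -
    have "d' \<otimes> d = \<one> \<oplus> (v \<otimes> (\<one> \<oplus> w) \<oplus> v \<otimes> w) \<oplus> (v \<otimes> (\<one> \<oplus> w)) \<otimes> (v \<otimes> w)"
      unfolding d_def d'_def using v w by (simp add: l_distr r_distr a_ac)
    also have "v \<otimes> (\<one> \<oplus> w) \<oplus> v \<otimes> w = v"
      using v w by (simp add: r_distr a_assoc add_self)
    also have "(v \<otimes> (\<one> \<oplus> w)) \<otimes> (v \<otimes> w) = \<nu> \<otimes> (v \<otimes> v)"
      unfolding \<nu>_def using v w vw[symmetric]
      by (simp add: l_distr r_distr m_assoc left_commute[OF vw[symmetric]])
    also have "\<one> \<oplus> v \<oplus> \<nu> \<otimes> (v \<otimes> v) = z"
      using v nc by (simp add: a_assoc zm)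
    finally show ?thesis .
  qed
  have dd': "d' \<otimes> d = d \<otimes> d'"
    using ycd(2)[OF dc(1)] vd by simp
  have "z [^] (2 ^ k :: nat) = \<one>"
    unfolding zm using zc nil by (simp add: one_add_pow_two_pow)
  then have zU: "z \<in> Units R" using zc unipotent_imp_Units by blast
  define di where "di = d' \<otimes> inv z"
  have di: "di \<in> carrier R" using dc zU by (simp add: di_def)
  have ddi: "d \<otimes> di = \<one>"
    unfolding di_def using dc zU dd' d'd by (simp add: m_assoc[symmetric])
  have did: "di \<otimes> d = \<one>"
  proof -
    have "inv z \<otimes> d' \<otimes> d = \<one>" using dc zU d'd by (simp add: m_assoc)
    then have "inv z \<otimes> d' = di"
      using dc zU di ddi by (metis inv_unique Units_inv_closed m_closed)
    then show ?thesis using \<open>inv z \<otimes> d' \<otimes> d = \<one>\<close> by simp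
  qed
  define fi where "fi = star di"
  have fi: "fi \<in> carrier R" using di by (simp add: fi_def)
  have ffi: "f \<otimes> fi = \<one>" "fi \<otimes> f = \<one>"
    unfolding fi_def sd(1)[symmetric] using ddi did dc di by (simp_all flip: star_mult)
  have sfi: "star fi = di" unfolding fi_def using di by simp
  have df: "d \<otimes> f = f \<otimes> d" "d \<otimes> f' = f' \<otimes> d"
    using ycf[OF dc(1)] vd by auto
  have gd: "g \<otimes> d = d \<otimes> g" using ycd[OF g(1)] vg wg by simp
  have gfi: "g \<otimes> fi = fi \<otimes> g"
    by (rule commute_inverse[OF ycf(1)[OF g(1)] ffi]) (use ug wg dc fi g in auto)
  have ff': "f \<otimes> f' = c \<otimes> z"
  proof -
    have "f \<otimes> f' = star z"
      unfolding sd[symmetric] d'd[symmetric] using dc by (simp add: star_mult)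
    also have "\<dots> = star \<theta> \<oplus> \<theta> \<otimes> c"
      unfolding z_def using c sc by (simp add: star_add star_mult) (metis sc star_star c(1))
    also have "\<dots> = c \<otimes> z"
      unfolding z_def using c cci theta_central[OF c(1)]
      by (simp add: r_distr m_assoc[symmetric] a_comm)
    finally show ?thesis .
  qed
  define s where "s = x \<otimes> (d \<otimes> fi)"
  have s: "s \<in> carrier R" using x dc fi by (simp add: s_def)
  have "s \<otimes> s = \<one>"
  proof -
    have sf: "s \<otimes> f = x \<otimes> d" using x dc fi ffi by (simp add: s_def m_assoc)
    have "s \<otimes> s \<otimes> (f \<otimes> f') = s \<otimes> (s \<otimes> f) \<otimes> f'"
      using s dc by (simp add: m_assoc)
    also have "\<dots> = s \<otimes> x \<otimes> (d \<otimes> f')"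
      unfolding sf using s dc x by (simp add: m_assoc)
    also have "\<dots> = x \<otimes> d \<otimes> fi \<otimes> (x \<otimes> f') \<otimes> d"
      unfolding df s_def using s dc x fi by (simp add: m_assoc)
    also have "\<dots> = x \<otimes> d \<otimes> (fi \<otimes> f) \<otimes> x \<otimes> d"
      unfolding fx[symmetric] using s dc x fi by (simp only: m_assoc m_closed)
    also have "\<dots> = x \<otimes> (d \<otimes> x) \<otimes> d"
      unfolding ffi using dc x by (simp add: m_assoc)
    also have "\<dots> = c \<otimes> (d' \<otimes> d)"
      unfolding dx c_def using dc x by (simp add: m_assoc)
    also have "\<dots> = f \<otimes> f'" unfolding d'd ff' ..
    finally have "s \<otimes> s \<otimes> (c \<otimes> z) = c \<otimes> z" unfolding ff' .
    then have "s \<otimes> s \<otimes> (c \<otimes> z) \<otimes> (inv z \<otimes> ci) = c \<otimes> z \<otimes> (inv z \<otimes> ci)" by simp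
    moreover have "c \<otimes> z \<otimes> (inv z \<otimes> ci) = \<one>"
    proof -
      have "c \<otimes> z \<otimes> (inv z \<otimes> ci) = c \<otimes> (z \<otimes> inv z) \<otimes> ci"
        using c zU zc by (simp only: m_assoc m_closed Units_inv_closed)
      then show ?thesis using c zU cci by simp
    qed
    ultimately show ?thesis
      using s c zU zc by (simp add: m_assoc[of "s \<otimes> s"])
  qed
  moreover have "star s \<otimes> s = \<one>"
  proof -
    have "star s = di \<otimes> f \<otimes> star x"
      unfolding s_def using x dc fi sfi sd by (simp add: star_mult)
    then have "star s \<otimes> s = di \<otimes> f \<otimes> (star x \<otimes> x) \<otimes> (d \<otimes> fi)"
      unfolding s_def using x dc fi di by (simp add: m_assoc)
    also have "\<dots> = di \<otimes> (f \<otimes> d) \<otimes> fi"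
      unfolding sx using x dc fi di by (simp add: m_assoc)
    also have "\<dots> = (di \<otimes> d) \<otimes> (f \<otimes> fi)"
      unfolding df(1)[symmetric] using dc fi di by (simp only: m_assoc m_closed)
    finally show ?thesis using did ffi by simp
  qed
  moreover have "s \<otimes> g = star g \<otimes> s"
  proof -
    have "s \<otimes> g = x \<otimes> (d \<otimes> (fi \<otimes> g))"
      unfolding s_def using x dc fi g by (simp add: m_assoc)
    also have "\<dots> = x \<otimes> (d \<otimes> g) \<otimes> fi"
      unfolding gfi[symmetric] using x dc fi g by (simp add: m_assoc)
    also have "\<dots> = (x \<otimes> g) \<otimes> (d \<otimes> fi)"
      unfolding gd[symmetric] using x dc fi g by (simp add: m_assoc)
    also have "\<dots> = star g \<otimes> s"
      unfolding xg s_def using x dc fi g by (simp add: m_assoc)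
    finally show ?thesis .
  qed
  ultimately show ?thesis using s by blast
qed

end

section \<open>Hermitian forms over a quadratic extension of finite fields of even order\<close>

lemma finite_carrier_mat: "finite (carrier_mat m n :: 'a :: finite mat set)"
proof -
  let ?I = "{..<m} \<times> {..<n}"
  have "carrier_mat m n \<subseteq> (\<lambda>f. mat m n f) ` (?I \<rightarrow>\<^sub>E (UNIV :: 'a set))"
  proof
    fix A :: "'a mat" assume A: "A \<in> carrier_mat m n"
    then have "A = mat m n (restrict (\<lambda>ij. A $$ ij) ?I)"
      by (intro eq_matI) (auto simp: restrict_def)
    moreover have "restrict (\<lambda>ij. A $$ ij) ?I \<in> ?I \<rightarrow>\<^sub>E UNIV" by auto
    ultimately show "A \<in> (\<lambda>f. mat m n f) ` (?I \<rightarrow>\<^sub>E UNIV)"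
      by (metis image_eqI)
  qed
  moreover have "finite (?I \<rightarrow>\<^sub>E (UNIV :: 'a set))"
    by (intro finite_PiE) auto
  ultimately show ?thesis by (rule finite_subset[OF _ finite_imageI])
qed

lemma square_mult_carrier [simp]:
  "A \<in> carrier_mat n n \<Longrightarrow> B \<in> carrier_mat n n \<Longrightarrow> A * B \<in> carrier_mat n n"
  by simp

text \<open>
  The dimension in the middle of a product does not occur in the conclusion of
  \<open>mult_carrier_mat\<close>, so the simplifier has to search for it; for square matrices it is known.
\<close>
declare mult_carrier_mat [simp del]

text \<open>
  The conjugate transpose, where $a \mapsto a^q$ is the conjugation of the field with $q^2$ elements.
\<close>
definition adj :: "nat \<Rightarrow> 'a :: monoid_mult mat \<Rightarrow> 'a mat" where
  "adj q A = transpose_mat (mat_bar q A)"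

lemma adj_carrier [simp]: "A \<in> carrier_mat m n \<Longrightarrow> adj q A \<in> carrier_mat n m"
  by (auto simp: adj_def mat_bar_def)

lemma adj_dim [simp]: "dim_row (adj q A) = dim_col A" "dim_col (adj q A) = dim_row A"
  by (auto simp: adj_def mat_bar_def)

lemma adj_index [simp]: "i < dim_col A \<Longrightarrow> j < dim_row A \<Longrightarrow> adj q A $$ (i, j) = (A $$ (j, i)) ^ q"
  by (auto simp: adj_def mat_bar_def)

definition direct_sum_mat :: "'a :: zero mat \<Rightarrow> 'a mat \<Rightarrow> 'a mat" where
  "direct_sum_mat A B = four_block_mat A (0\<^sub>m (dim_row A) (dim_col B)) (0\<^sub>m (dim_row B) (dim_col A)) B"

lemma direct_sum_mat_eq:
  "A \<in> carrier_mat m m \<Longrightarrow> B \<in> carrier_mat n n \<Longrightarrow>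
    direct_sum_mat A B = four_block_mat A (0\<^sub>m m n) (0\<^sub>m n m) B"
  by (simp add: direct_sum_mat_def)

lemma direct_sum_mat_carrier [simp]:
  "A \<in> carrier_mat m m \<Longrightarrow> B \<in> carrier_mat n n \<Longrightarrow> direct_sum_mat A B \<in> carrier_mat (m + n) (m + n)"
  by (simp add: direct_sum_mat_def)

lemma direct_sum_mat_mult:
  fixes A B :: "'a :: semiring_1 mat"
  assumes "A \<in> carrier_mat m m" "B \<in> carrier_mat n n" "C \<in> carrier_mat m m" "D \<in> carrier_mat n n"
  shows "direct_sum_mat A B * direct_sum_mat C D = direct_sum_mat (A * C) (B * D)"
  using assms by (simp add: direct_sum_mat_def mult_four_block_mat[of _ m m _ n _ n _ _ m _ n])

lemma direct_sum_mat_one [simp]: "direct_sum_mat (1\<^sub>m m) (1\<^sub>m n) = 1\<^sub>m (m + n)"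
  by (simp add: direct_sum_mat_def)

lemma det_direct_sum_mat:
  fixes A B :: "'a :: idom mat"
  assumes "A \<in> carrier_mat m m" "B \<in> carrier_mat n n"
  shows "det (direct_sum_mat A B) = det A * det B"
  using assms by (simp add: direct_sum_mat_eq det_four_block_mat_lower_left_zero[of _ m _ n])

locale quadratic_field_char2 =
  fixes q e :: nat and F :: "'a :: finite_field itself"
  assumes q_def: "q = 2 ^ e" and e_pos: "e \<ge> 1" and card_field: "CARD('a) = q\<^sup>2"
begin

lemma char_2: "CHAR('a) = 2"
proof -
  have "CHAR('a) dvd 2 ^ (e * 2)"
    using CHAR_dvd_CARD[where 'a = 'a] card_field q_def by (simp add: power_mult)
  then show ?thesis
    using CHAR_prime[where 'a = 'a] prime_dvd_power primes_dvd_imp_eq two_is_prime_nat by blast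
qed

lemma add_self: "(x :: 'a) + x = 0"
  using uminus_CHAR_2[OF char_2, of x] by (metis add.right_inverse)

lemma q_pos: "q > 0"
  by (simp add: q_def)

lemma bar_add: "((x :: 'a) + y) ^ q = x ^ q + y ^ q"
  using freshmans_dream'[of q e x y] char_2 q_def two_is_prime_nat by simp

lemma bar_bar: "((x :: 'a) ^ q) ^ q = x"
  using finite_field_power_card_eq_same[of x] card_field by (simp add: power2_eq_square power_mult)

sublocale bar: semiring_hom "\<lambda>x :: 'a. x ^ q"
  by unfold_locales (use q_pos bar_add in \<open>auto simp: power_mult_distrib\<close>)

text \<open>
  The polynomial $X^q + X$ has at most $q$ roots, so some $x$ has nonzero trace $t = x + x^q$. Since
  $t^q = t$, the element $x / t$ has trace $1$.
\<close>
lemma trace_one_exists: "\<exists>\<theta> :: 'a. \<theta> + \<theta> ^ q = 1"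
proof -
  define p :: "'a poly" where "p = Polynomial.monom 1 q + Polynomial.monom 1 1"
  have q1: "q > 1" using q_def e_pos one_less_power[of "2 :: nat" e] by simp
  have "Polynomial.coeff p q = 1" using q1 by (simp add: p_def)
  then have p0: "p \<noteq> 0" by auto
  have "Polynomial.degree p \<le> q"
    unfolding p_def using q1 by (intro degree_add_le) (auto simp: degree_monom_eq)
  then have "card {x. poly p x = 0} \<le> q"
    using card_poly_roots_bound[OF p0] by simp
  moreover have "q < CARD('a)" using card_field q1 by (simp add: power2_eq_square)
  ultimately obtain x where "poly p x \<noteq> 0"
    by (metis (mono_tags, lifting) Collect_cong UNIV_def linorder_not_le)
  then have x: "x + x ^ q \<noteq> 0" by (simp add: p_def poly_monom add.commute)
  define t where "t = x + x ^ q"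
  have t: "t ^ q = t" unfolding t_def by (simp add: bar_add bar_bar add.commute)
  have "x / t + (x / t) ^ q = (x + x ^ q) / t"
    by (simp add: power_divide t add_divide_distrib)
  then have "x / t + (x / t) ^ q = 1" using x by (simp add: t_def)
  then show ?thesis by blast
qed

lemma adj_adj [simp]: "adj q (adj q (A :: 'a mat)) = A"
  by (rule eq_matI) (simp_all add: bar_bar)

lemma adj_add: 
  fixes A B :: "'a mat"
  assumes "A \<in> carrier_mat m n" "B \<in> carrier_mat m n"
  shows "adj q (A + B) = adj q A + adj q B"
  using assms by (intro eq_matI) (auto simp: bar_add)

lemma adj_mult: 
  fixes A B :: "'a mat"
  assumes "A \<in> carrier_mat l m" "B \<in> carrier_mat m n"
  shows "adj q (A * B) = adj q B * adj q A"
  unfolding adj_def mat_bar_def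
  by (subst bar.mat_hom_mult[OF assms], subst transpose_mult[of _ l m _ n]) (use assms in auto)

lemma adj_one [simp]: "adj q (1\<^sub>m n :: 'a mat) = 1\<^sub>m n"
  by (intro eq_matI) (use q_pos in auto)

lemma adj_zero [simp]: "adj q (0\<^sub>m m n :: 'a mat) = 0\<^sub>m n m"
  by (intro eq_matI) (use q_pos in auto)

lemma adj_smult: "adj q (c \<cdot>\<^sub>m (A :: 'a mat)) = c ^ q \<cdot>\<^sub>m adj q A"
  by (intro eq_matI) (auto simp: power_mult_distrib)

lemma adj_four_block:
  fixes A :: "'a mat"
  assumes "A \<in> carrier_mat k l" "B \<in> carrier_mat k n" "C \<in> carrier_mat m l" "D \<in> carrier_mat m n"
  shows "adj q (four_block_mat A B C D) = four_block_mat (adj q A) (adj q C) (adj q B) (adj q D)"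
  using assms by (intro eq_matI) auto

lemma mat_add_self: "(A :: 'a mat) \<in> carrier_mat m n \<Longrightarrow> A + A = 0\<^sub>m m n"
  by (intro eq_matI) (auto simp: add_self)

definition hermitian_form :: "nat \<Rightarrow> 'a mat \<Rightarrow> bool" where
  "hermitian_form n H \<longleftrightarrow> H \<in> carrier_mat n n \<and> adj q H = H \<and> det H \<noteq> 0"

definition isometry :: "'a mat \<Rightarrow> 'a mat \<Rightarrow> bool" where
  "isometry H A \<longleftrightarrow> adj q A * H * A = H"

text \<open>
  The form is part of the existential statement. This makes the property invariant under similarity,
  so that it can be checked on a normal form of $A$.
\<close>
definition isometric_involution_product :: "nat \<Rightarrow> 'a mat \<Rightarrow> bool" where
  "isometric_involution_product n A \<longleftrightarrow> (\<exists>H s t. hermitian_form n H \<and>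
     s \<in> carrier_mat n n \<and> t \<in> carrier_mat n n \<and> s * s = 1\<^sub>m n \<and> t * t = 1\<^sub>m n \<and>
     isometry H s \<and> isometry H t \<and> A = s * t)"

lemma isometric_involution_product_mult:
  assumes "hermitian_form n H" "s \<in> carrier_mat n n" "t \<in> carrier_mat n n"
    and "s * s = 1\<^sub>m n" "t * t = 1\<^sub>m n" "isometry H s" "isometry H t"
  shows "isometric_involution_product n (s * t)"
  unfolding isometric_involution_product_def using assms by blast

lemma mat_inverse_exists:
  fixes H :: "'a mat"
  assumes "H \<in> carrier_mat n n" "det H \<noteq> 0"
  obtains K where "K \<in> carrier_mat n n" "K * H = 1\<^sub>m n" "H * K = 1\<^sub>m n"
  using det_non_zero_imp_unit[OF assms, of "()"] unfolding Units_def by (auto simp: ring_mat_def)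

lemma mat_det_nonzero:
  fixes H :: "'a mat"
  assumes "H \<in> carrier_mat n n" "K \<in> carrier_mat n n" "K * H = 1\<^sub>m n"
  shows "det H \<noteq> 0"
  using det_mult[OF assms(2,1)] assms(3) by auto

text \<open>
  The adjoint of $A$ with respect to $H$ is $H^{-1} \bar{A}^T H$; here $K = H^{-1}$.
\<close>
lemma hermitian_star_ring:
  assumes H: "hermitian_form n H" and K: "K \<in> carrier_mat n n" "K * H = 1\<^sub>m n" "H * K = 1\<^sub>m n"
    and \<theta>: "\<theta> + \<theta> ^ q = 1"
  shows "finite_char2_star_ring (ring_mat TYPE('a) n ()) (\<lambda>A. K * adj q A * H) (\<theta> \<cdot>\<^sub>m 1\<^sub>m n)"
proof -
  let ?R = "ring_mat TYPE('a) n ()"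
  interpret ring ?R by (rule ring_mat)
  note R = ring_mat_simps[of "TYPE('a)" n "()"]
  have Hc: "H \<in> carrier_mat n n" and sH: "adj q H = H"
    using H by (auto simp: hermitian_form_def)
  have sK: "adj q K = K"
  proof -
    have "H * adj q K = 1\<^sub>m n"
      using adj_mult[OF K(1) Hc] sH K by simp
    then have "K * (H * adj q K) = K" using K by simp
    then show ?thesis using K Hc by (simp add: assoc_mult_mat[of K n n H n _ n, symmetric])
  qed
  note assoc = assoc_mult_mat[of _ n n _ n _ n]
  note unassoc = assoc_mult_mat[of _ n n _ n _ n, symmetric]
  have KHx: "K * (H * M) = M" "H * (K * M) = M" if "M \<in> carrier_mat n n" for M
    using that K Hc by (simp_all add: unassoc)
  show ?thesis
  proof (intro finite_char2_star_ring.intro ring_mat finite_char2_star_ring_axioms.intro; unfold R)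
    fix A :: "'a mat" assume A: "A \<in> carrier_mat n n"
    show "A + A = 0\<^sub>m n n" by (rule mat_add_self[OF A])
    show "K * adj q A * H \<in> carrier_mat n n" using A K Hc by auto
    show "K * adj q (K * adj q A * H) * H = A"
      using A K Hc sH sK KHx by (simp add: adj_mult[of _ n n _ n] assoc)
    show "A * (\<theta> \<cdot>\<^sub>m 1\<^sub>m n) = \<theta> \<cdot>\<^sub>m 1\<^sub>m n * A"
      using A by (simp add: mult_smult_distrib[of _ n n _ n] mult_smult_assoc_mat[of _ n n _ n])
    fix B :: "'a mat" assume B: "B \<in> carrier_mat n n"
    show "K * adj q (A + B) * H = K * adj q A * H + K * adj q B * H"
      using A B K Hc
      by (simp add: adj_add[of _ n n] mult_add_distrib_mat[of _ n n _ n] add_mult_distrib_mat[of _ n n _ _ n])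
    show "K * adj q (A * B) * H = (K * adj q B * H) * (K * adj q A * H)"
      using A B K Hc KHx by (simp add: adj_mult[of _ n n _ n] assoc)
  next
    show "K * adj q (\<theta> \<cdot>\<^sub>m 1\<^sub>m n) * H = 1\<^sub>m n + \<theta> \<cdot>\<^sub>m 1\<^sub>m n"
    proof -
      have "K * adj q (\<theta> \<cdot>\<^sub>m 1\<^sub>m n) * H = \<theta> ^ q \<cdot>\<^sub>m 1\<^sub>m n"
        using K Hc by (simp add: adj_smult mult_smult_distrib[of _ n n _ n] mult_smult_assoc_mat[of _ n n _ n])
      also have "\<theta> ^ q = 1 + \<theta>"
        using \<theta> add_self by (metis add.assoc add_0 add.commute)
      finally show ?thesis by (auto intro!: eq_matI)
    qed
    show "finite (carrier_mat n n :: 'a mat set)" by (rule finite_carrier_mat)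
    show "\<theta> \<cdot>\<^sub>m 1\<^sub>m n \<in> carrier_mat n n" by simp
  qed
qed

lemma isometry_mult:
  assumes "H \<in> carrier_mat n n" "A \<in> carrier_mat n n" "B \<in> carrier_mat n n"
    and "isometry H A" "isometry H B"
  shows "isometry H (A * B)"
proof -
  note assoc = assoc_mult_mat[of _ n n _ n _ n]
  have "adj q (A * B) * H * (A * B) = adj q B * (adj q A * H * A) * B"
    using assms(1-3) by (simp add: adj_mult[of _ n n _ n] assoc)
  then show ?thesis using assms by (simp add: isometry_def)
qed

lemma isometric_involution_productI:
  assumes "hermitian_form n H" "s \<in> carrier_mat n n" "A \<in> carrier_mat n n"
    and "s * s = 1\<^sub>m n" "isometry H s" "isometry H A" "s * A * s * A = 1\<^sub>m n"
  shows "isometric_involution_product n A"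
proof -
  note assoc = assoc_mult_mat[of _ n n _ n _ n]
  note unassoc = assoc_mult_mat[of _ n n _ n _ n, symmetric]
  have H: "H \<in> carrier_mat n n" using assms(1) by (simp add: hermitian_form_def)
  have "(s * A) * (s * A) = 1\<^sub>m n" using assms(2,3,7) by (simp add: assoc)
  moreover have "A = s * (s * A)" using assms(2-4) by (simp add: unassoc)
  ultimately show ?thesis
    unfolding isometric_involution_product_def
    using assms isometry_mult[OF H assms(2,3,5,6)]
    by (intro exI[of _ H] exI[of _ s] exI[of _ "s * A"]) auto
qed

text \<open>
  The matrix $A$ preserves both the form $H$ of the two involutions and the standard form, hence
  commutes with $H$. Write $H = b^* b$ where $b$ commutes with $A$. Then $b$ is an isometry from $H$ to the
  standard form, and conjugation by $b$ makes $s$ unitary without changing $A$.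
\<close>
lemma isometric_involution_product_strongly_real:
  assumes A: "isometric_involution_product n A" and u: "adj q A * A = 1\<^sub>m n"
  obtains s where "s \<in> carrier_mat n n" "s * s = 1\<^sub>m n" "adj q s * s = 1\<^sub>m n" "s * A * s * A = 1\<^sub>m n"
proof -
  obtain H s t where H: "hermitian_form n H" and s: "s \<in> carrier_mat n n" "t \<in> carrier_mat n n"
    and ss: "s * s = 1\<^sub>m n" "t * t = 1\<^sub>m n" and iso: "isometry H s" "isometry H t" and Ast: "A = s * t"
    using A unfolding isometric_involution_product_def by blast
  have Hc: "H \<in> carrier_mat n n" "adj q H = H" "det H \<noteq> 0" using H by (auto simp: hermitian_form_def)
  have Ac: "A \<in> carrier_mat n n" using s Ast by simp
  note assoc = assoc_mult_mat[of _ n n _ n _ n]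
  note unassoc = assoc_mult_mat[of _ n n _ n _ n, symmetric]
  obtain \<theta> :: 'a where \<theta>: "\<theta> + \<theta> ^ q = 1" using trace_one_exists by blast
  have one: "hermitian_form n (1\<^sub>m n)" by (simp add: hermitian_form_def)
  interpret S: finite_char2_star_ring "ring_mat TYPE('a) n ()" "\<lambda>A. 1\<^sub>m n * adj q A * 1\<^sub>m n" "\<theta> \<cdot>\<^sub>m 1\<^sub>m n"
    by (rule hermitian_star_ring[OF one _ _ _ \<theta>]) auto
  note R = ring_mat_simps[of "TYPE('a)" n "()"]
  have "H \<in> Units (ring_mat TYPE('a) n ())"
    by (rule det_non_zero_imp_unit[OF Hc(1,3)])
  from S.selfadjoint_unit_is_norm[OF this, unfolded R] Hc obtain b where
    b: "b \<in> carrier_mat n n" "adj q b * b = H"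
    and bc: "\<And>y. y \<in> carrier_mat n n \<Longrightarrow> y * H = H * y \<Longrightarrow> y * b = b * y"
    by auto
  have Au: "A * adj q A = 1\<^sub>m n"
    by (rule mat_mult_left_right_inverse[OF _ Ac u]) (use Ac in auto)
  have "isometry H A" unfolding Ast by (rule isometry_mult[OF Hc(1) s iso])
  then have "A * (adj q A * H * A) = A * H" by (simp add: isometry_def)
  then have "A * H = H * A"
    using Ac Hc Au by (simp add: unassoc)
  then have bA: "A * b = b * A" using bc Ac by blast
  have "det (adj q b) * det b \<noteq> 0"
    using det_mult[of "adj q b" n b] b Hc by simp
  then have "det b \<noteq> 0" by auto
  then obtain bi where bi: "bi \<in> carrier_mat n n" "bi * b = 1\<^sub>m n" "b * bi = 1\<^sub>m n"
    using mat_inverse_exists[OF b(1)] by blast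
  have bix: "bi * (b * M) = M" "b * (bi * M) = M" if "M \<in> carrier_mat n n" for M
    using that b bi by (simp_all add: unassoc)
  have ssx: "s * (s * M) = M" "t * (t * M) = M" if "M \<in> carrier_mat n n" for M
    using that s ss by (simp_all add: unassoc)
  have biA: "bi * A = A * bi"
  proof -
    have "bi * (A * b) * bi = bi * (b * A) * bi" using bA by simp
    then show ?thesis using b bi bix Ac by (simp add: assoc)
  qed
  define s' where "s' = b * s * bi"
  have s'c: "s' \<in> carrier_mat n n" using b s bi by (simp add: s'_def)
  have 1: "s' * s' = 1\<^sub>m n"
    unfolding s'_def using b s bi bix ssx by (simp add: assoc)
  have 2: "adj q s' * s' = 1\<^sub>m n"
  proof -
    have bb: "adj q bi * adj q b = 1\<^sub>m n"
      using adj_mult[OF b(1) bi(1)] bi(3) by simp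
    have "adj q s' * s' = adj q bi * (adj q s * (adj q b * b) * s) * bi"
      unfolding s'_def using b(1) s bi(1) by (simp add: adj_mult[of _ n n _ n] assoc)
    also have "adj q s * (adj q b * b) * s = adj q b * b"
      using iso b(2) by (simp add: isometry_def)
    also have "adj q bi * (adj q b * b) * bi = (adj q bi * adj q b) * (b * bi)"
      using b(1) bi(1) by (simp add: assoc)
    finally show ?thesis using bb bi by simp
  qed
  have 3: "s' * A * s' * A = 1\<^sub>m n"
  proof -
    have "s' * A = b * (s * A) * bi"
      unfolding s'_def using b(1) s bi(1) Ac by (simp add: assoc biA)
    also have "s * A = t" unfolding Ast using s ssx by simp
    finally have "s' * A = b * t * bi" .
    moreover have "s' * A * s' * A = (s' * A) * (s' * A)"
      using s'c Ac by (simp add: assoc)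
    ultimately show ?thesis
      using b s bi bix ssx by (simp add: assoc)
  qed
  show ?thesis using that[OF s'c 1 2 3] .
qed

text \<open>
  The equation \<open>g * x * g = x\<close> expresses that $x$ conjugates $g$ to its inverse, and the matrix
  $1 + g$ is inverted in order to obtain the Artin-Schreier generator $w$ of
  \<open>involution_in_inverting_coset\<close>.
\<close>
lemma isometric_involution_product_of_real:
  assumes H: "hermitian_form n H" and g: "g \<in> carrier_mat n n" "isometry H g"
    and x: "x \<in> carrier_mat n n" "isometry H x" and gxg: "g * x * g = x"
    and nofix: "det (1\<^sub>m n + g) \<noteq> 0"
  shows "isometric_involution_product n g"
proof -
  have Hc: "H \<in> carrier_mat n n" "adj q H = H" "det H \<noteq> 0" using H by (auto simp: hermitian_form_def)
  note assoc = assoc_mult_mat[of _ n n _ n _ n]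
  note unassoc = assoc_mult_mat[of _ n n _ n _ n, symmetric]
  obtain \<theta> :: 'a where \<theta>: "\<theta> + \<theta> ^ q = 1" using trace_one_exists by blast
  obtain K where K: "K \<in> carrier_mat n n" "K * H = 1\<^sub>m n" "H * K = 1\<^sub>m n"
    using mat_inverse_exists[OF Hc(1,3)] .
  define star where "star = (\<lambda>A. K * adj q A * H)"
  interpret S: finite_char2_star_ring "ring_mat TYPE('a) n ()" star "\<theta> \<cdot>\<^sub>m 1\<^sub>m n"
    unfolding star_def by (rule hermitian_star_ring[OF H K \<theta>])
  note R = ring_mat_simps[of "TYPE('a)" n "()"]
  have KHx: "K * (H * M) = M" "H * (K * M) = M" if "M \<in> carrier_mat n n" for M
    using that K Hc by (simp_all add: unassoc)
  have iso: "isometry H y \<longleftrightarrow> star y * y = 1\<^sub>m n" if "y \<in> carrier_mat n n" for y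
  proof
    assume "isometry H y"
    then have "K * (adj q y * H * y) = 1\<^sub>m n" using K by (simp add: isometry_def)
    then show "star y * y = 1\<^sub>m n" unfolding star_def using K Hc that by (simp add: assoc)
  next
    assume "star y * y = 1\<^sub>m n"
    then have "H * (star y * y) = H" using Hc by simp
    then show "isometry H y"
      unfolding star_def isometry_def using K Hc that KHx by (simp add: assoc)
  qed
  have sc: "star y \<in> carrier_mat n n" if "y \<in> carrier_mat n n" for y
    using that K Hc by (simp add: star_def assoc)
  have 1: "star g * g = 1\<^sub>m n" "star x * x = 1\<^sub>m n" using iso g x by auto
  have 2: "g * star g = 1\<^sub>m n" "x * star x = 1\<^sub>m n"
    using mat_mult_left_right_inverse[OF sc _ 1(1)] mat_mult_left_right_inverse[OF sc _ 1(2)] g x by auto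
  have 3: "x * g = star g * x"
  proof -
    have "star g * (g * x * g) = star g * x" using gxg by simp
    moreover have "star g * (g * x * g) = (star g * g) * (x * g)"
      using g(1) x(1) sc[OF g(1)] by (simp add: assoc)
    ultimately show ?thesis using 1 g(1) x(1) by simp
  qed
  obtain w where w: "w \<in> carrier_mat n n" "w * (1\<^sub>m n + g) = 1\<^sub>m n" "(1\<^sub>m n + g) * w = 1\<^sub>m n"
    using mat_inverse_exists[OF _ nofix, of n] g by auto
  obtain s where s: "s \<in> carrier_mat n n" "s * s = 1\<^sub>m n" "star s * s = 1\<^sub>m n" "s * g = star g * s"
    using S.involution_in_inverting_coset[unfolded R, OF g(1) 1(1) 2(1) x(1) 1(2) 2(2) 3 w(1,3,2)] by blast
  have "s * g * s * g = star g * (s * s) * g"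
    using s g sc by (simp add: assoc)
  then have "s * g * s * g = 1\<^sub>m n" using s(2) 1(1) sc[OF g(1)] by simp
  then show ?thesis
    using isometric_involution_productI[OF H s(1) g(1) s(2)] iso s g by blast
qed

lemma isometric_involution_product_similar:
  assumes "similar_mat A B" "isometric_involution_product n B"
  shows "isometric_involution_product n A"
proof -
  obtain H s t where H: "hermitian_form n H" and s: "s \<in> carrier_mat n n" "t \<in> carrier_mat n n"
    and ss: "s * s = 1\<^sub>m n" "t * t = 1\<^sub>m n" and iso: "isometry H s" "isometry H t" and Bst: "B = s * t"
    using assms(2) unfolding isometric_involution_product_def by blast
  have Hc: "H \<in> carrier_mat n n" "adj q H = H" "det H \<noteq> 0" using H by (auto simp: hermitian_form_def)
  note assoc = assoc_mult_mat[of _ n n _ n _ n]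
  note unassoc = assoc_mult_mat[of _ n n _ n _ n, symmetric]
  have Bc: "B \<in> carrier_mat n n" using s Bst by simp
  obtain m P Q where "{A, B, P, Q} \<subseteq> carrier_mat m m"
    and PQ: "P * Q = 1\<^sub>m m" "Q * P = 1\<^sub>m m" and APQ: "A = P * B * Q"
    using similar_matD[OF assms(1)] by blast
  moreover from this Bc have "m = n" by auto
  ultimately have P: "P \<in> carrier_mat n n" "Q \<in> carrier_mat n n" and PQ: "P * Q = 1\<^sub>m n" "Q * P = 1\<^sub>m n"
    by auto
  have PQx: "P * (Q * M) = M" "Q * (P * M) = M" if "M \<in> carrier_mat n n" for M
    using that P PQ by (simp_all add: unassoc)
  have sPQ: "adj q P * (adj q Q * M) = M" if "M \<in> carrier_mat n n" for M
  proof -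
    have "adj q P * adj q Q = 1\<^sub>m n" using adj_mult[OF P(2,1)] PQ by simp
    then show ?thesis using that P by (simp add: unassoc)
  qed
  have inv: "y' * y' = 1\<^sub>m n \<and> y' \<in> carrier_mat n n \<and> isometry (adj q Q * H * Q) y'"
    if "y \<in> carrier_mat n n" "y * y = 1\<^sub>m n" "isometry H y" "y' = P * y * Q" for y y'
  proof -
    have yy: "y * (y * M) = M" if "M \<in> carrier_mat n n" for M
      using that \<open>y * y = 1\<^sub>m n\<close> \<open>y \<in> _\<close> by (simp add: unassoc)
    have "adj q y' * (adj q Q * H * Q) * y' = adj q Q * (adj q y * H * y) * Q"
      using that(1,4) P Hc PQx sPQ by (simp add: adj_mult[of _ n n _ n] assoc)
    then have "isometry (adj q Q * H * Q) y'"
      using that(3) by (simp add: isometry_def)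
    then show ?thesis using that P PQ PQx yy by (simp add: assoc)
  qed
  have "det Q \<noteq> 0" using mat_det_nonzero[OF P(2,1) PQ(1)] .
  moreover have "det (adj q Q) \<noteq> 0"
    using mat_det_nonzero[of "adj q Q" n "adj q P"] P sPQ[of "1\<^sub>m n"] by simp
  ultimately have "hermitian_form n (adj q Q * H * Q)"
    unfolding hermitian_form_def using P Hc by (simp add: adj_mult[of _ n n _ n] assoc det_mult[of _ n])
  moreover have "A = P * s * Q * (P * t * Q)"
    unfolding APQ Bst using s P PQx by (simp add: assoc)
  ultimately show ?thesis
    unfolding isometric_involution_product_def
    using inv[OF s(1) ss(1) iso(1) refl] inv[OF s(2) ss(2) iso(2) refl] by blast
qed

lemma isometric_involution_product_direct_sum_mat:
  assumes "isometric_involution_product m A" "isometric_involution_product n B"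
  shows "isometric_involution_product (m + n) (direct_sum_mat A B)"
proof -
  obtain H s t where H: "hermitian_form m H" and s: "s \<in> carrier_mat m m" "t \<in> carrier_mat m m"
    and ss: "s * s = 1\<^sub>m m" "t * t = 1\<^sub>m m" and iso: "isometry H s" "isometry H t" and A: "A = s * t"
    using assms(1) unfolding isometric_involution_product_def by blast
  obtain H' s' t' where H': "hermitian_form n H'" and s': "s' \<in> carrier_mat n n" "t' \<in> carrier_mat n n"
    and ss': "s' * s' = 1\<^sub>m n" "t' * t' = 1\<^sub>m n" and iso': "isometry H' s'" "isometry H' t'" and B: "B = s' * t'"
    using assms(2) unfolding isometric_involution_product_def by blast
  have Hc: "H \<in> carrier_mat m m" "adj q H = H" "det H \<noteq> 0" using H by (auto simp: hermitian_form_def)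
  have Hc': "H' \<in> carrier_mat n n" "adj q H' = H'" "det H' \<noteq> 0" using H' by (auto simp: hermitian_form_def)
  have adj2: "adj q (direct_sum_mat M N) = direct_sum_mat (adj q M) (adj q N)"
    if "M \<in> carrier_mat m m" "N \<in> carrier_mat n n" for M N :: "'a mat"
    using adj_four_block[of M m m "0\<^sub>m m n" n "0\<^sub>m n m" n N] that by (simp add: direct_sum_mat_def)
  have "hermitian_form (m + n) (direct_sum_mat H H')"
    unfolding hermitian_form_def using Hc Hc' adj2
    by (simp add: det_direct_sum_mat)
  moreover have "isometry (direct_sum_mat H H') (direct_sum_mat y y')"
    if "y \<in> carrier_mat m m" "y' \<in> carrier_mat n n" "isometry H y" "isometry H' y'" for y y'
    using that Hc Hc' unfolding isometry_def
    by (simp add: adj2 direct_sum_mat_mult[of _ m _ n])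
  moreover have "direct_sum_mat A B = direct_sum_mat s s' * direct_sum_mat t t'"
    unfolding A B using s s' by (simp add: direct_sum_mat_mult)
  moreover have "direct_sum_mat y y' * direct_sum_mat y y' = 1\<^sub>m (m + n)"
    if "y \<in> carrier_mat m m" "y' \<in> carrier_mat n n" "y * y = 1\<^sub>m m" "y' * y' = 1\<^sub>m n" for y y' :: "'a mat"
    using that by (simp add: direct_sum_mat_mult[of _ m _ n])
  ultimately show ?thesis
    unfolding isometric_involution_product_def using s s' ss ss' iso iso'
    by (intro exI[of _ "direct_sum_mat H H'"] exI[of _ "direct_sum_mat s s'"] exI[of _ "direct_sum_mat t t'"]) auto
qed

end

section \<open>Isometric involutions for unipotent Jordan blocks\<close>

text \<open>
  Let $N = A - a$ and let $e$ be the last basis vector. The columns $N^{k-1-j} e$ of \<open>P\<close> form a Jordan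
  chain. In \<open>P\<close> the diagonal entries are products of superdiagonal entries of $A$, and the entries
  below vanish, so \<open>P\<close> is invertible.
\<close>
lemma similar_single_jordan_block:
  fixes A :: "'a :: field mat"
  assumes A: "A \<in> carrier_mat k k"
    and low: "\<And>i j. i < k \<Longrightarrow> j < i \<Longrightarrow> A $$ (i, j) = 0"
    and diag: "\<And>i. i < k \<Longrightarrow> A $$ (i, i) = a"
    and super: "\<And>i. Suc i < k \<Longrightarrow> A $$ (i, Suc i) \<noteq> 0"
  shows "similar_mat A (jordan_block k a)"
proof -
  define N where "N = mat k k (\<lambda>(i, j). if i = j then 0 else A $$ (i, j))"
  have Nc: "N \<in> carrier_mat k k" by (simp add: N_def)
  define M where "M = (\<lambda>m. ((*) N ^^ m) (1\<^sub>m k))"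
  have M0: "M 0 = 1\<^sub>m k" and MS: "M (Suc m) = N * M m" for m
    by (simp_all add: M_def)
  have Mc: "M m \<in> carrier_mat k k" for m
    by (induction m) (use Nc in \<open>simp_all add: M0 MS\<close>)
  have MSi: "M (Suc m) $$ (i, j) = (\<Sum>l\<in>{0..<k}. N $$ (i, l) * M m $$ (l, j))"
    if "i < k" "j < k" for i j m
    unfolding MS using that Nc Mc[of m] by (simp add: scalar_prod_def)
  have N0: "N $$ (i, l) = 0" if "i < k" "l < k" "l \<le> i" for i l
    using that low by (auto simp: N_def)
  have Mlow: "(j < i + m \<longrightarrow> M m $$ (i, j) = 0) \<and> (j = i + m \<longrightarrow> M m $$ (i, j) \<noteq> 0)"
    if "i < k" "j < k" for i j m
    using that
  proof (induction m arbitrary: i j)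
    case 0
    then show ?case by (auto simp: M0)
  next
    case (Suc m)
    show ?case
    proof (intro conjI impI)
      assume j: "j < i + Suc m"
      have "N $$ (i, l) * M m $$ (l, j) = 0" if "l < k" for l
        using Suc.IH[OF that Suc.prems(2)] N0[OF Suc.prems(1) that] j by (cases "l \<le> i") auto
      then show "M (Suc m) $$ (i, j) = 0"
        unfolding MSi[OF Suc.prems] by (intro sum.neutral) auto
    next
      assume j: "j = i + Suc m"
      have Si: "Suc i < k" using j Suc.prems by simp
      have "N $$ (i, l) * M m $$ (l, j) = 0" if "l < k" "l \<noteq> Suc i" for l
        using Suc.IH[OF that(1) Suc.prems(2)] N0[OF Suc.prems(1) that(1)] j that by (cases "l \<le> i") auto
      then have "M (Suc m) $$ (i, j) = (\<Sum>l\<in>{Suc i}. N $$ (i, l) * M m $$ (l, j))"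
        unfolding MSi[OF Suc.prems] by (intro sum.mono_neutral_right) (use Si in auto)
      also have "\<dots> \<noteq> 0"
        using Suc.IH[OF Si Suc.prems(2)] super[OF Si] Si j by (simp add: N_def)
      finally show "M (Suc m) $$ (i, j) \<noteq> 0" .
    qed
  qed
  define P where "P = mat k k (\<lambda>(i, j). M (k - 1 - j) $$ (i, k - 1))"
  have Pc: "P \<in> carrier_mat k k" by (simp add: P_def)
  have "upper_triangular P"
    using Mlow by (auto simp: P_def)
  then have "det P = prod_list (diag_mat P)" using det_upper_triangular Pc by blast
  moreover have "0 \<notin> set (diag_mat P)"
  proof
    assume "0 \<in> set (diag_mat P)"
    then obtain i where i: "i < k" "M (k - 1 - i) $$ (i, k - 1) = 0"
      by (auto simp: diag_mat_def P_def)
    then show False using Mlow[of i "k - 1" "k - 1 - i"] by auto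
  qed
  ultimately have "det P \<noteq> 0" by (simp add: prod_list_zero_iff)
  from det_non_zero_imp_unit[OF Pc this, of "()"] obtain Q where
    Q: "Q \<in> carrier_mat k k" "Q * P = 1\<^sub>m k" "P * Q = 1\<^sub>m k"
    unfolding Units_def by (auto simp: ring_mat_def)
  have AP: "A * P = P * jordan_block k a"
  proof (rule eq_matI)
    fix i j assume "i < dim_row (P * jordan_block k a)" "j < dim_col (P * jordan_block k a)"
    then have ij: "i < k" "j < k" using Pc by auto
    have "(A * P) $$ (i, j) = (\<Sum>l\<in>{0..<k}. A $$ (i, l) * P $$ (l, j))"
      using ij A Pc by (simp add: scalar_prod_def)
    also have "\<dots> = (\<Sum>l\<in>{0..<k}. N $$ (i, l) * P $$ (l, j) + (if l = i then a * P $$ (i, j) else 0))"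
      by (intro sum.cong) (use ij diag in \<open>auto simp: N_def\<close>)
    also have "\<dots> = (\<Sum>l\<in>{0..<k}. N $$ (i, l) * M (k - 1 - j) $$ (l, k - 1)) + a * P $$ (i, j)"
      using ij by (simp add: sum.distrib P_def)
    also have "(\<Sum>l\<in>{0..<k}. N $$ (i, l) * M (k - 1 - j) $$ (l, k - 1))
        = M (Suc (k - 1 - j)) $$ (i, k - 1)"
      using ij by (subst MSi) auto
    also have "\<dots> = (if j = 0 then 0 else P $$ (i, j - 1))"
    proof (cases "j = 0")
      case True
      then show ?thesis using ij Mlow[of i "k - 1" "Suc (k - 1 - j)"] by simp
    next
      case False
      then have "Suc (k - 1 - j) = k - 1 - (j - 1)" using ij by simp
      then show ?thesis using ij False by (simp add: P_def)
    qed
    also have "\<dots> + a * P $$ (i, j) = (P * jordan_block k a) $$ (i, j)"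
    proof -
      have "(P * jordan_block k a) $$ (i, j) = (\<Sum>l\<in>{0..<k}. P $$ (i, l) * jordan_block k a $$ (l, j))"
        using ij Pc by (simp add: scalar_prod_def)
      also have "\<dots> = (\<Sum>l\<in>{0..<k}. (if l = j then a * P $$ (i, j) else 0)
          + (if l = j - 1 then (if j = 0 then 0 else P $$ (i, j - 1)) else 0))"
        by (intro sum.cong) (use ij in auto)
      also have "\<dots> = a * P $$ (i, j) + (if j = 0 then 0 else P $$ (i, j - 1))"
        using ij by (simp add: sum.distrib)
      finally show ?thesis by simp
    qed
    finally show "(A * P) $$ (i, j) = (P * jordan_block k a) $$ (i, j)" .
  qed (use A Pc in auto)
  have "A = A * (P * Q)" using A Q by simp
  also have "\<dots> = A * P * Q" by (rule assoc_mult_mat[OF A Pc Q(1), symmetric])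
  finally have "A = P * jordan_block k a * Q" unfolding AP .
  then show ?thesis
    by (intro similar_matI[of _ _ P Q k]) (use A Pc Q in auto)
qed

context quadratic_field_char2
begin

text \<open>
  Every other arrow of the string $e_{k-1} \mapsto \dots \mapsto e_1 \mapsto e_0$, added to the identity.
  The two values of \<open>b\<close> select complementary sets of arrows. No two selected arrows are
  composable, so the nilpotent part has square $0$.
\<close>
definition string_involution :: "nat \<Rightarrow> bool \<Rightarrow> 'a mat" where
  "string_involution k b = mat k k (\<lambda>(i, j). if j = i \<or> j = Suc i \<and> even i = b then 1 else 0)"

definition antidiagonal :: "nat \<Rightarrow> 'a mat" where
  "antidiagonal k = mat k k (\<lambda>(i, j). if i + j + 1 = k then 1 else 0)"

lemma string_involution_carrier [simp]: "string_involution k b \<in> carrier_mat k k"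
  by (simp add: string_involution_def)

lemma antidiagonal_carrier [simp]: "antidiagonal k \<in> carrier_mat k k"
  by (simp add: antidiagonal_def)

lemma string_involution_mult_index:
  assumes "M \<in> carrier_mat k k" "i < k" "j < k"
  shows "(string_involution k b * M) $$ (i, j)
    = M $$ (i, j) + (if Suc i < k \<and> even i = b then M $$ (Suc i, j) else 0)"
proof -
  have "(string_involution k b * M) $$ (i, j)
      = (\<Sum>l\<in>{0..<k}. string_involution k b $$ (i, l) * M $$ (l, j))"
    using assms by (simp add: scalar_prod_def string_involution_def)
  also have "\<dots> = (\<Sum>l\<in>{0..<k}. (if l = i then M $$ (i, j) else 0)
      + (if l = Suc i then (if even i = b then M $$ (Suc i, j) else 0) else 0))"
    by (intro sum.cong) (use assms in \<open>auto simp: string_involution_def\<close>)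
  also have "\<dots> = M $$ (i, j) + (if Suc i < k \<and> even i = b then M $$ (Suc i, j) else 0)"
    using assms by (simp add: sum.distrib)
  finally show ?thesis .
qed

lemma antidiagonal_mult_index:
  assumes "M \<in> carrier_mat k k" "i < k" "j < k"
  shows "(antidiagonal k * M) $$ (i, j) = M $$ (k - 1 - i, j)"
    and "(M * antidiagonal k) $$ (i, j) = M $$ (i, k - 1 - j)"
proof -
  have "(antidiagonal k * M) $$ (i, j) = (\<Sum>l\<in>{0..<k}. antidiagonal k $$ (i, l) * M $$ (l, j))"
    using assms by (simp add: scalar_prod_def antidiagonal_def)
  also have "\<dots> = (\<Sum>l\<in>{0..<k}. if l = k - 1 - i then M $$ (k - 1 - i, j) else 0)"
    by (intro sum.cong) (use assms in \<open>auto simp: antidiagonal_def\<close>)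
  finally show "(antidiagonal k * M) $$ (i, j) = M $$ (k - 1 - i, j)"
    using assms by simp
  have "(M * antidiagonal k) $$ (i, j) = (\<Sum>l\<in>{0..<k}. M $$ (i, l) * antidiagonal k $$ (l, j))"
    using assms by (simp add: scalar_prod_def antidiagonal_def)
  also have "\<dots> = (\<Sum>l\<in>{0..<k}. if l = k - 1 - j then M $$ (i, k - 1 - j) else 0)"
    by (intro sum.cong) (use assms in \<open>auto simp: antidiagonal_def\<close>)
  finally show "(M * antidiagonal k) $$ (i, j) = M $$ (i, k - 1 - j)"
    using assms by simp
qed

lemma string_involution_square: "string_involution k b * string_involution k b = 1\<^sub>m k"
proof (rule eq_matI)
  fix i j assume ij: "i < dim_row (1\<^sub>m k :: 'a mat)" "j < dim_col (1\<^sub>m k :: 'a mat)"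
  then have "(string_involution k b * string_involution k b) $$ (i, j) =
      string_involution k b $$ (i, j)
        + (if Suc i < k \<and> even i = b then string_involution k b $$ (Suc i, j) else 0)"
    by (intro string_involution_mult_index) auto
  also have "\<dots> = 1\<^sub>m k $$ (i, j)"
    using ij by (auto simp: string_involution_def add_self)
  finally show "(string_involution k b * string_involution k b) $$ (i, j) = 1\<^sub>m k $$ (i, j)" .
qed (simp_all add: string_involution_def)

lemma antidiagonal_square: "antidiagonal k * antidiagonal k = 1\<^sub>m k"
proof (rule eq_matI)
  fix i j assume "i < dim_row (1\<^sub>m k :: 'a mat)" "j < dim_col (1\<^sub>m k :: 'a mat)"
  then show "(antidiagonal k * antidiagonal k) $$ (i, j) = 1\<^sub>m k $$ (i, j)"
    by (subst antidiagonal_mult_index(1)) (auto simp: antidiagonal_def)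
qed (simp_all add: antidiagonal_def)

lemma hermitian_form_antidiagonal: "hermitian_form k (antidiagonal k)"
proof -
  have "adj q (antidiagonal k) = antidiagonal k"
    by (intro eq_matI) (use q_pos in \<open>auto simp: antidiagonal_def\<close>)
  then show ?thesis
    using mat_det_nonzero[OF _ _ antidiagonal_square] by (simp add: hermitian_form_def)
qed

text \<open>
  With respect to the antidiagonal form the adjoint of the arrow $e_{i+1} \mapsto e_i$ is the arrow
  $e_{k-1-i} \mapsto e_{k-2-i}$. Its target has the same parity if and only if $k$ is even.
\<close>
lemma string_involution_adjoint:
  assumes "b' = (if even k then b else \<not> b)"
  shows "adj q (string_involution k b) * antidiagonal k * string_involution k b' = antidiagonal k"
proof -
  let ?S = "string_involution k"
  have "adj q (?S b) * antidiagonal k = antidiagonal k * ?S b'"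
  proof (rule eq_matI)
    fix i j assume "i < dim_row (antidiagonal k * ?S b')" "j < dim_col (antidiagonal k * ?S b')"
    then have ij: "i < k" "j < k" by (auto simp: antidiagonal_def string_involution_def)
    have "(adj q (?S b) * antidiagonal k) $$ (i, j) = adj q (?S b) $$ (i, k - 1 - j)"
      using ij by (intro antidiagonal_mult_index) auto
    also have "\<dots> = (?S b $$ (k - 1 - j, i)) ^ q"
      using ij by (intro adj_index) (auto simp: string_involution_def)
    also have "\<dots> = ?S b' $$ (k - 1 - i, j)"
    proof (cases "i + j = k")
      case True
      then obtain i' j' where "i = Suc i'" "j = Suc j'" and k: "k = Suc (Suc (i' + j'))"
        using ij by (cases i; cases j) auto
      then have "k - 1 - j = i'" "k - 1 - i = j'" "Suc i' = i" "Suc j' = j" by auto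
      moreover have "even i' = b \<longleftrightarrow> even j' = b'"
        using assms by (auto simp: k)
      ultimately show ?thesis
        using ij q_pos by (auto simp: string_involution_def)
    next
      case False
      have "i = k - 1 - j \<longleftrightarrow> j = k - 1 - i" "i \<noteq> Suc (k - 1 - j)" "j \<noteq> Suc (k - 1 - i)"
        using ij False by auto
      then show ?thesis
        using ij q_pos by (simp add: string_involution_def)
    qed
    also have "\<dots> = (antidiagonal k * ?S b') $$ (i, j)"
      using ij by (intro antidiagonal_mult_index(1)[symmetric]) auto
    finally show "(adj q (?S b) * antidiagonal k) $$ (i, j) = (antidiagonal k * ?S b') $$ (i, j)" .
  qed (auto simp: string_involution_def antidiagonal_def)
  then show ?thesis
    by (simp add: assoc_mult_mat[of _ k k _ k _ k] string_involution_square right_mult_one_mat[of _ k k])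
qed

text \<open>
  Exactly one of the two factors contains the arrow $e_{i+1} \mapsto e_i$, so all superdiagonal entries
  of the product are $1$.
\<close>
lemma jordan_block_similar_string_product:
  assumes "b' = (\<not> b)"
  shows "similar_mat (jordan_block k 1) (string_involution k b * string_involution k b')"
proof -
  let ?A = "string_involution k b * string_involution k b'"
  have idx: "?A $$ (i, j) = string_involution k b' $$ (i, j)
      + (if Suc i < k \<and> even i = b then string_involution k b' $$ (Suc i, j) else 0)"
    if "i < k" "j < k" for i j
    using that by (intro string_involution_mult_index) auto
  have "similar_mat ?A (jordan_block k 1)"
  proof (rule similar_single_jordan_block)
    fix i j assume "i < k" "j < i"
    then show "?A $$ (i, j) = 0" by (subst idx) (auto simp: string_involution_def)
  next
    fix i assume "i < k"
    then show "?A $$ (i, i) = 1" by (subst idx) (auto simp: string_involution_def)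
  next
    fix i assume "Suc i < k"
    then show "?A $$ (i, Suc i) \<noteq> 0"
      using assms by (subst idx) (auto simp: string_involution_def)
  qed simp
  then show ?thesis by (rule similar_mat_sym)
qed

lemma isometric_involution_product_even_block:
  assumes "even k"
  shows "isometric_involution_product k (jordan_block k 1)"
proof (rule isometric_involution_product_similar)
  show "similar_mat (jordan_block k 1) (string_involution k True * string_involution k False)"
    by (rule jordan_block_similar_string_product) simp
  show "isometric_involution_product k (string_involution k True * string_involution k False)"
    unfolding isometric_involution_product_def isometry_def
    using string_involution_adjoint[of True k True] string_involution_adjoint[of False k False] assms
    by (intro exI[of _ "antidiagonal k"] exI[of _ "string_involution k True"]
        exI[of _ "string_involution k False"])
      (simp add: hermitian_form_antidiagonal string_involution_square)
qed

lemma isometric_involution_product_one_block: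
  "isometric_involution_product 1 (jordan_block 1 1)"
proof -
  have "jordan_block 1 1 = (1\<^sub>m 1 :: 'a mat)" by (intro eq_matI) auto
  then show ?thesis
    unfolding isometric_involution_product_def isometry_def hermitian_form_def
    by (intro exI[of _ "1\<^sub>m 1"]) simp
qed

text \<open>
  For odd $k$ the antidiagonal form pairs the two string involutions $S$ and $T$ with each other. Hence
  $S \oplus T$ and $T \oplus S$ preserve the form that pairs the first summand with the second one.
\<close>
lemma isometric_involution_product_odd_pair:
  assumes "odd k"
  shows "isometric_involution_product (k + k) (direct_sum_mat (jordan_block k 1) (jordan_block k 1))"
proof (rule isometric_involution_product_similar)
  let ?S = "string_involution k True" and ?T = "string_involution k False" and ?J = "antidiagonal k"
  let ?H = "four_block_mat (0\<^sub>m k k) ?J ?J (0\<^sub>m k k)"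
  show "similar_mat (direct_sum_mat (jordan_block k 1) (jordan_block k 1)) (direct_sum_mat (?S * ?T) (?T * ?S))"
    unfolding direct_sum_mat_def
    using similar_mat_four_block_0_0[OF jordan_block_similar_string_product[of False True k]
        jordan_block_similar_string_product[of True False k]]
    by (simp add: string_involution_def)
  have adJ: "adj q ?J = ?J"
    using hermitian_form_antidiagonal by (simp add: hermitian_form_def)
  note zero = left_mult_zero_mat[of _ k k] right_mult_zero_mat[of _ k k]
  have "?H * ?H = 1\<^sub>m (k + k)"
    by (simp add: mult_four_block_mat[of _ k k _ k _ k _ _ k _ k] antidiagonal_square zero)
  then have "det ?H \<noteq> 0"
    using mat_det_nonzero[of ?H "k + k" ?H] by simp
  then have H: "hermitian_form (k + k) ?H"
    by (simp add: hermitian_form_def adj_four_block[of _ k k _ k _ k] adJ)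
  have iso: "isometry ?H (direct_sum_mat (string_involution k b) (string_involution k (\<not> b)))" for b
  proof -
    have "adj q (direct_sum_mat (string_involution k b) (string_involution k (\<not> b)))
        = four_block_mat (adj q (string_involution k b)) (0\<^sub>m k k) (0\<^sub>m k k) (adj q (string_involution k (\<not> b)))"
      by (simp add: direct_sum_mat_eq[of _ k _ k] adj_four_block[of _ k k _ k _ k])
    then show ?thesis
      unfolding isometry_def
      using string_involution_adjoint[of "\<not> b" k b] string_involution_adjoint[of b k "\<not> b"] assms
      by (simp add: direct_sum_mat_eq[of _ k _ k] mult_four_block_mat[of _ k k _ k _ k _ _ k _ k] zero)
  qed
  show "isometric_involution_product (k + k) (direct_sum_mat (?S * ?T) (?T * ?S))"
    unfolding isometric_involution_product_def
    using H iso[of True] iso[of False]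
    by (intro exI[of _ ?H] exI[of _ "direct_sum_mat ?S ?T"] exI[of _ "direct_sum_mat ?T ?S"])
      (simp add: direct_sum_mat_mult[of _ k _ k] string_involution_square)
qed

text \<open>
  Let $w, p, p', v$ be a basis with the antidiagonal form. The involution $s$ adds to the identity the map
  $v \mapsto p$, $p' \mapsto w$, and $t$ adds the map $v \mapsto \omega p'$, $p \mapsto \bar\omega w$. Both
  maps are self-adjoint of square $0$. For $N = st - 1$ one finds $Nv = p + \omega p' + \omega w$,
  $N^2 v = (\omega + \bar\omega) w$ and $N^3 = 0$, so trace $1$ gives a Jordan chain of length $3$. The
  vector $p + \bar\omega p'$ in the kernel of $N$ spans the remaining block. For $\omega$ in the subfield the
  trace is $0$ and $N^2 = 0$.
\<close>
lemma isometric_involution_product_three_one: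
  "isometric_involution_product 4 (direct_sum_mat (jordan_block 3 1) (jordan_block 1 1))"
proof -
  obtain \<omega> :: 'a where om: "\<omega> + \<omega> ^ q = 1" using trace_one_exists by blast
  have two: "x + (x + y) = y" for x y :: 'a
    using add_self[of x] by (simp add: add.assoc[symmetric])
  have omq: "\<omega> ^ q = 1 + \<omega>"
    using two[of \<omega> "\<omega> ^ q"] by (simp add: om add.commute)
  define s :: "'a mat" where
    "s = mat 4 4 (\<lambda>(i, j). if i = j \<or> i = 0 \<and> j = 2 \<or> i = 1 \<and> j = 3 then 1 else 0)"
  define t :: "'a mat" where
    "t = mat 4 4 (\<lambda>(i, j). if i = j then 1 else if i = 0 \<and> j = 1 then 1 + \<omega>
      else if i = 2 \<and> j = 3 then \<omega> else 0)"
  (* The columns are N^2 v = w, N v, v and the kernel vector p + (1 + \<omega>) p'; Q is the inverse. *)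
  define P :: "'a mat" where
    "P = mat 4 4 (\<lambda>(i, j). if j = 0 then (if i = 0 then 1 else 0)
      else if j = 1 then (if i = 1 then 1 else if i = 3 then 0 else \<omega>)
      else if j = 2 then (if i = 3 then 1 else 0)
      else if i = 1 then 1 else if i = 2 then 1 + \<omega> else 0)"
  define Q :: "'a mat" where
    "Q = mat 4 4 (\<lambda>(i, j). if i = 0 then
        (if j = 0 then 1 else if j = 1 then \<omega> * (1 + \<omega>) else if j = 2 then \<omega> else 0)
      else if i = 1 then (if j = 1 then 1 + \<omega> else if j = 2 then 1 else 0)
      else if i = 2 then (if j = 3 then 1 else 0)
      else if j = 1 then \<omega> else if j = 2 then 1 else 0)"
  define D :: "'a mat" where "D = direct_sum_mat (jordan_block 3 1) (jordan_block 1 1)"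
  have D: "D = mat 4 4 (\<lambda>(i, j). if i = j \<or> i = 0 \<and> j = 1 \<or> i = 1 \<and> j = 2 then 1 else 0)"
    by (rule eq_matI) (auto simp: direct_sum_mat_def D_def)
  have c: "s \<in> carrier_mat 4 4" "t \<in> carrier_mat 4 4" "P \<in> carrier_mat 4 4" "Q \<in> carrier_mat 4 4"
    "antidiagonal 4 \<in> carrier_mat 4 4"
    by (simp_all add: s_def t_def P_def Q_def)
  have cD: "D \<in> carrier_mat 4 4" unfolding D by simp
  have four: "i < 4 \<longleftrightarrow> i = 0 \<or> i = 1 \<or> i = 2 \<or> i = 3" for i :: nat
    by auto
  have eq4: "A = B" if "A \<in> carrier_mat 4 4" "B \<in> carrier_mat 4 4"
    "\<And>i j. i = 0 \<or> i = 1 \<or> i = 2 \<or> i = 3 \<Longrightarrow> j = 0 \<or> j = 1 \<or> j = 2 \<or> j = 3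
      \<Longrightarrow> A $$ (i, j) = B $$ (i, j)" for A B :: "'a mat"
    by (rule eq_matI) (use that four in auto)
  have mul4: "(A * B) $$ (i, j) = A $$ (i, 0) * B $$ (0, j) + (A $$ (i, 1) * B $$ (1, j)
      + (A $$ (i, 2) * B $$ (2, j) + A $$ (i, 3) * B $$ (3, j)))"
    if "A \<in> carrier_mat 4 4" "B \<in> carrier_mat 4 4" "i < 4" "j < 4" for A B :: "'a mat" and i j
  proof -
    have "{0..<4} = {0, 1, 2, 3::nat}" by auto
    then show ?thesis using that by (simp add: scalar_prod_def add.assoc)
  qed
  have omq2: "(1 + \<omega>) ^ q = \<omega>"
    by (simp add: bar_add omq two)
  note ent = s_def t_def P_def Q_def D antidiagonal_def
  note ring = algebra_simps add_self two
  have omq2: "(1 + \<omega>) ^ q = \<omega>"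
    by (simp add: bar_add omq two)
  have ss: "s * s = 1\<^sub>m 4"
    by (rule eq4, use c cD in simp, use c cD in simp, subst mul4[OF c(1,1)], simp only: four, simp only: four,
        (elim disjE; simp add: ent ring))
  have tt: "t * t = 1\<^sub>m 4"
    by (rule eq4, use c cD in simp, use c cD in simp, subst mul4[OF c(2,2)], simp only: four, simp only: four,
        (elim disjE; simp add: ent ring))
  have PQ: "P * Q = 1\<^sub>m 4"
    by (rule eq4, use c cD in simp, use c cD in simp, subst mul4[OF c(3,4)], simp only: four, simp only: four,
        (elim disjE; simp add: ent ring))
  (* E is the product t P. *)
  define E :: "'a mat" where
    "E = mat 4 4 (\<lambda>(i, j). if j = 0 then (if i = 0 then 1 else 0)
      else if j = 1 then (if i = 2 then \<omega> else if i = 3 then 0 else 1)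
      else if j = 2 then (if i = 2 then \<omega> else if i = 3 then 1 else 0)
      else if i = 1 then 1 else if i = 3 then 0 else 1 + \<omega>)"
  have E: "E \<in> carrier_mat 4 4" by (simp add: E_def)
  have tP: "t * P = E"
    by (rule eq4, use c E in simp, use E in simp, subst mul4[OF c(2,3)], simp only: four, simp only: four,
        (elim disjE; simp add: ent E_def ring))
  have "P * D = s * E"
    by (rule eq4, use c cD in simp, use c E in simp, subst mul4[OF c(3) cD], simp only: four, simp only: four,
        subst mul4[OF c(1) E], simp only: four, simp only: four,
        (elim disjE; simp add: ent E_def ring))
  then have PD: "P * D = s * (t * P)" by (simp add: tP)
  have aJ: "adj q s * antidiagonal 4 = antidiagonal 4 * s"
    by (rule eq4, use c cD in simp, use c cD in simp,
        subst mul4[OF adj_carrier[OF c(1)] c(5)], simp only: four, simp only: four,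
        subst mul4[OF c(5,1)], simp only: four, simp only: four,
        (elim disjE; simp add: ent ring))
  have tJ: "adj q t * antidiagonal 4 = antidiagonal 4 * t"
    by (rule eq4, use c cD in simp, use c cD in simp,
        subst mul4[OF adj_carrier[OF c(2)] c(5)], simp only: four, simp only: four,
        subst mul4[OF c(5,2)], simp only: four, simp only: four,
        (elim disjE; simp add: ent ring omq omq2))
  have QP: "Q * P = 1\<^sub>m 4"
    by (rule mat_mult_left_right_inverse[OF c(3,4) PQ])
  note assoc = assoc_mult_mat[of _ 4 4 _ 4 _ 4]
  have "Q * (P * D) = D"
    using c cD QP by (simp flip: assoc)
  then have "D = Q * (s * t) * P"
    unfolding PD using c by (simp add: assoc)
  then have "similar_mat D (s * t)"
    by (intro similar_matI[of _ _ Q P 4]) (use c cD PQ QP in auto)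
  moreover have "isometry (antidiagonal 4) s" "isometry (antidiagonal 4) t"
    unfolding isometry_def aJ tJ
    using c ss tt by (simp_all add: assoc right_mult_one_mat[of _ 4 4])
  then have "isometric_involution_product 4 (s * t)"
    by (intro isometric_involution_product_mult[OF hermitian_form_antidiagonal c(1,2) ss tt])
  ultimately show ?thesis
    unfolding D_def by (rule isometric_involution_product_similar)
qed

end

lemma direct_sum_mat_eq_diag_block_mat: "direct_sum_mat A B = diag_block_mat [A, B]"
  by (simp only: direct_sum_mat_def diag_block_mat.simps(2)[of A "[B]"] diag_block_mat_singleton Let_def)

lemma similar_mat_direct_sum_mat:
  assumes "similar_mat A A'" "similar_mat B B'"
  shows "similar_mat (direct_sum_mat A B) (direct_sum_mat A' B')"
  using similar_diag_mat_block_mat[of "[(A, A'), (B, B')]"] assms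
  by (auto simp: direct_sum_mat_eq_diag_block_mat)

lemma jordan_matrix_append: "jordan_matrix (xs @ ys) = direct_sum_mat (jordan_matrix xs) (jordan_matrix ys)"
  unfolding jordan_matrix_def direct_sum_mat_def by (simp add: diag_block_mat_append Let_def)

lemma similar_mat_direct_sum_mat_swap:
  fixes A B :: "'a :: field mat"
  assumes A: "A \<in> carrier_mat m m" and B: "B \<in> carrier_mat n n"
  shows "similar_mat (direct_sum_mat A B) (direct_sum_mat B A)"
proof -
  let ?P = "four_block_mat (0\<^sub>m m n) (1\<^sub>m m) (1\<^sub>m n) (0\<^sub>m n m) :: 'a mat"
  let ?Q = "four_block_mat (0\<^sub>m n m) (1\<^sub>m n) (1\<^sub>m m) (0\<^sub>m m n) :: 'a mat"
  have P: "?P \<in> carrier_mat (m + n) (m + n)" and Q: "?Q \<in> carrier_mat (m + n) (m + n)"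
    by (intro carrier_matI; simp)+
  have z: "0\<^sub>m m n * 0\<^sub>m n m = (0\<^sub>m m m :: 'a mat)" "0\<^sub>m n m * 0\<^sub>m m n = (0\<^sub>m n n :: 'a mat)"
    "0\<^sub>m m n * B = 0\<^sub>m m n" "0\<^sub>m n m * A = 0\<^sub>m n m" "A * 0\<^sub>m m n = 0\<^sub>m m n" "B * 0\<^sub>m n m = 0\<^sub>m n m"
    using A B by auto
  have PQ: "?P * ?Q = 1\<^sub>m (m + n)"
    by (simp add: mult_four_block_mat[of _ m n _ m _ n _ _ m _ n] z)
  have QP: "?Q * ?P = 1\<^sub>m (m + n)"
    by (rule mat_mult_left_right_inverse[OF P Q PQ])
  have "?P * direct_sum_mat B A = four_block_mat (0\<^sub>m m n) A B (0\<^sub>m n m)"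
    unfolding direct_sum_mat_eq[OF B A]
    using A B by (simp add: mult_four_block_mat[of _ m n _ m _ n _ _ n _ m] z)
  also have "\<dots> * ?Q = direct_sum_mat A B"
    unfolding direct_sum_mat_eq[OF A B]
    using A B by (simp add: mult_four_block_mat[of _ m n _ m _ n _ _ m _ n] z)
  finally have "direct_sum_mat A B = ?P * direct_sum_mat B A * ?Q" by simp
  then show ?thesis
    by (intro similar_matI[of _ _ ?P ?Q "m + n"]) (use A B P Q PQ QP in \<open>auto simp: direct_sum_mat_def\<close>)
qed

definition unipotent_jordan_matrix :: "nat list \<Rightarrow> 'a :: {zero, one} mat" where
  "unipotent_jordan_matrix ks = jordan_matrix (map (\<lambda>k. (k, 1)) ks)"

lemma unipotent_jordan_matrix_carrier [simp]:
  "unipotent_jordan_matrix ks \<in> carrier_mat (sum_list ks) (sum_list ks)"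
  using jordan_matrix_carrier[of "map (\<lambda>k. (k, 1)) ks"]
  by (simp add: unipotent_jordan_matrix_def o_def)

lemma unipotent_jordan_matrix_append:
  "unipotent_jordan_matrix (ks @ ls) = direct_sum_mat (unipotent_jordan_matrix ks) (unipotent_jordan_matrix ls)"
  by (simp add: unipotent_jordan_matrix_def jordan_matrix_append)

lemma unipotent_jordan_matrix_single: "unipotent_jordan_matrix [k] = jordan_block k 1"
  by (simp only: unipotent_jordan_matrix_def jordan_matrix_def list.map prod.case diag_block_mat_singleton)

lemma similar_unipotent_jordan_matrix_swap:
  "similar_mat (unipotent_jordan_matrix (ks @ ls @ ms) :: 'a :: field mat)
     (unipotent_jordan_matrix (ls @ ks @ ms))"
proof -
  have "similar_mat (direct_sum_mat (unipotent_jordan_matrix (ks @ ls)) (unipotent_jordan_matrix ms))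
     (direct_sum_mat (unipotent_jordan_matrix (ls @ ks)) (unipotent_jordan_matrix ms) :: 'a mat)"
    unfolding unipotent_jordan_matrix_append[of ks ls] unipotent_jordan_matrix_append[of ls ks]
    by (intro similar_mat_direct_sum_mat similar_mat_direct_sum_mat_swap[OF unipotent_jordan_matrix_carrier unipotent_jordan_matrix_carrier])
      (rule similar_mat_refl[OF unipotent_jordan_matrix_carrier])
  then show ?thesis
    by (simp flip: unipotent_jordan_matrix_append)
qed

context quadratic_field_char2
begin

lemma isometric_involution_product_append:
  assumes "isometric_involution_product (sum_list ks) (unipotent_jordan_matrix ks)"
    and "isometric_involution_product (sum_list ls) (unipotent_jordan_matrix ls)"
  shows "isometric_involution_product (sum_list (ks @ ls)) (unipotent_jordan_matrix (ks @ ls))"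
  using isometric_involution_product_direct_sum_mat[OF assms]
  by (simp add: unipotent_jordan_matrix_append)

text \<open>
  Only the multiset of block sizes matters; this is the instance used for regrouping blocks.
\<close>
lemma isometric_involution_product_move_to_front:
  assumes "isometric_involution_product (sum_list (k # us @ vs)) (unipotent_jordan_matrix (k # us @ vs))"
  shows "isometric_involution_product (sum_list (us @ k # vs)) (unipotent_jordan_matrix (us @ k # vs))"
proof -
  have "similar_mat (unipotent_jordan_matrix (us @ k # vs) :: 'a mat) (unipotent_jordan_matrix (k # us @ vs))"
    using similar_unipotent_jordan_matrix_swap[of us "[k]" vs] by simp
  from isometric_involution_product_similar[OF this assms] show ?thesis by (simp add: ac_simps)
qed

text \<open>
  Blocks of even size and of size $1$ are treated one at a time, the remaining ones in equal pairs.
\<close>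
lemma isometric_involution_product_even_multiplicities:
  assumes "\<forall>m\<ge>1. even (count_list ks (2 * m + 1))"
  shows "isometric_involution_product (sum_list ks) (unipotent_jordan_matrix ks)"
  using assms
proof (induction ks rule: length_induct)
  case (1 ks)
  show ?case
  proof (cases ks)
    case Nil
    have "unipotent_jordan_matrix [] = (0\<^sub>m 0 0 :: 'a mat)"
      by (simp add: unipotent_jordan_matrix_def jordan_matrix_def)
    moreover have "isometric_involution_product 0 (0\<^sub>m 0 0)"
      unfolding isometric_involution_product_def hermitian_form_def isometry_def
      by (intro exI[of _ "0\<^sub>m 0 0"]) auto
    ultimately show ?thesis using Nil by simp
  next
    case (Cons k ls)
    show ?thesis
    proof (cases "even k \<or> k = 1")
      case True
      then have "isometric_involution_product (sum_list [k]) (unipotent_jordan_matrix [k])"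
        unfolding unipotent_jordan_matrix_single
        using isometric_involution_product_even_block isometric_involution_product_one_block by auto
      moreover have "isometric_involution_product (sum_list ls) (unipotent_jordan_matrix ls)"
      proof (rule 1(1)[rule_format])
        show "length ls < length ks" using Cons by simp
        fix m :: nat assume "m \<ge> 1"
        then have "k \<noteq> 2 * m + 1" using True by auto
        then show "even (count_list ls (2 * m + 1))"
          using 1(2) \<open>m \<ge> 1\<close> Cons by auto
      qed
      ultimately show ?thesis
        using isometric_involution_product_append[of "[k]" ls] Cons by simp
    next
      case False
      then obtain l where l: "k = 2 * l + 1" by (auto elim: oddE)
      with False have "l \<ge> 1" by simp
      then have "even (count_list ks k)" using 1(2) l by blast
      then have "count_list ls k \<noteq> 0" using Cons by (cases "count_list ls k = 0") auto
      then have "k \<in> set ls" using count_notin by metis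
      then obtain us vs where ls: "ls = us @ k # vs" by (meson split_list)
      have "isometric_involution_product (sum_list [k, k]) (unipotent_jordan_matrix [k, k])"
      proof -
        have "unipotent_jordan_matrix [k, k] = (direct_sum_mat (jordan_block k 1) (jordan_block k 1) :: 'a mat)"
          using unipotent_jordan_matrix_append[of "[k]" "[k]"] by (simp add: unipotent_jordan_matrix_single)
        then show ?thesis using isometric_involution_product_odd_pair[of k] False by simp
      qed
      moreover have "isometric_involution_product (sum_list (us @ vs)) (unipotent_jordan_matrix (us @ vs))"
      proof (rule 1(1)[rule_format])
        show "length (us @ vs) < length ks" using Cons ls by simp
        fix m :: nat assume "m \<ge> 1"
        then have "even (count_list ks (2 * m + 1))" using 1(2) by blast
        then show "even (count_list (us @ vs) (2 * m + 1))"
          using Cons ls by (auto split: if_splits)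
      qed
      ultimately have "isometric_involution_product (sum_list (k # k # us @ vs)) (unipotent_jordan_matrix (k # k # us @ vs))"
        using isometric_involution_product_append[of "[k, k]" "us @ vs"] by simp
      then show ?thesis
        using isometric_involution_product_move_to_front[of k "k # us" vs] Cons ls by simp
    qed
  qed
qed

text \<open>
  If there is an odd number of blocks of size $3$, then one of them is combined with a block of size $1$,
  and all other odd block sizes greater than $1$ have even multiplicity.
\<close>
lemma isometric_involution_product_unipotent:
  assumes "(\<forall>m\<ge>1. even (count_list ks (2 * m + 1))) \<or>
    (count_list ks 1 > 0 \<and> (\<forall>m\<ge>2. even (count_list ks (2 * m + 1))))"
  shows "isometric_involution_product (sum_list ks) (unipotent_jordan_matrix ks)"
proof (cases "\<forall>m\<ge>1. even (count_list ks (2 * m + 1))")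
  case True
  then show ?thesis by (rule isometric_involution_product_even_multiplicities)
next
  case False
  then have 1: "count_list ks 1 > 0" and ev: "\<And>m. m \<ge> 2 \<Longrightarrow> even (count_list ks (2 * m + 1))"
    and odd: "\<exists>m\<ge>1. odd (count_list ks (2 * m + 1))"
    using assms by auto
  from odd ev have odd3: "odd (count_list ks 3)"
    by (metis One_nat_def Suc_1 le_antisym mult_2 not_less_eq_eq numeral_3_eq_3 one_add_one add.commute plus_1_eq_Suc)
  then have "3 \<in> set ks" by (metis count_notin even_zero)
  then obtain us vs where ks: "ks = us @ 3 # vs" by (meson split_list)
  have "count_list (us @ vs) 1 \<noteq> 0" using 1 ks by simp
  then have "1 \<in> set (us @ vs)" by (metis count_notin)
  then obtain us' vs' where uv: "us @ vs = us' @ 1 # vs'" by (meson split_list)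
  have cnt: "count_list ks k = count_list (us' @ vs') k + (if k = 3 then 1 else 0) + (if k = 1 then 1 else 0)" for k
  proof -
    have "count_list ks k = count_list (us @ vs) k + (if k = 3 then 1 else 0)" by (simp add: ks)
    then show ?thesis unfolding uv by simp
  qed
  have "isometric_involution_product (sum_list (us' @ vs')) (unipotent_jordan_matrix (us' @ vs'))"
  proof (rule isometric_involution_product_even_multiplicities, intro allI impI)
    fix m :: nat assume m: "m \<ge> 1"
    show "even (count_list (us' @ vs') (2 * m + 1))"
    proof (cases "m = 1")
      case True
      then show ?thesis using odd3 cnt[of 3] by simp
    next
      case False
      then show ?thesis using ev[of m] cnt[of "2 * m + 1"] m by simp
    qed
  qed
  moreover have "isometric_involution_product (sum_list [3, 1]) (unipotent_jordan_matrix [3, 1])"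
  proof -
    have "unipotent_jordan_matrix [3, 1] = (direct_sum_mat (jordan_block 3 1) (jordan_block 1 1) :: 'a mat)"
      using unipotent_jordan_matrix_append[of "[3]" "[1]"] by (simp add: unipotent_jordan_matrix_single)
    then show ?thesis using isometric_involution_product_three_one by simp
  qed
  ultimately have "isometric_involution_product (sum_list (3 # 1 # us' @ vs')) (unipotent_jordan_matrix (3 # 1 # us' @ vs'))"
    using isometric_involution_product_append[of "[3, 1]" "us' @ vs'"] by simp
  then have "isometric_involution_product (sum_list (1 # (3 # us') @ vs')) (unipotent_jordan_matrix (1 # (3 # us') @ vs'))"
    using isometric_involution_product_move_to_front[of 3 "[1]" "us' @ vs'"] by simp
  then have "isometric_involution_product (sum_list (3 # us @ vs)) (unipotent_jordan_matrix (3 # us @ vs))"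
    using isometric_involution_product_move_to_front[of 1 "3 # us'" vs'] uv by simp
  then show ?thesis
    using isometric_involution_product_move_to_front[of 3 us vs] ks by simp
qed

end

section \<open>The generalized eigenspace of the eigenvalue one\<close>

text \<open>
  Complete the eigenvector to a basis.
\<close>
lemma similar_first_column_eigenvector:
  fixes A :: "'a :: field mat"
  assumes A: "A \<in> carrier_mat (Suc n) (Suc n)"
    and v: "v \<in> carrier_vec (Suc n)" "v \<noteq> 0\<^sub>v (Suc n)" "A *\<^sub>v v = a \<cdot>\<^sub>v v"
  shows "\<exists>C D. C \<in> carrier_mat 1 n \<and> D \<in> carrier_mat n n \<and>
    similar_mat A (four_block_mat (a \<cdot>\<^sub>m 1\<^sub>m 1) C (0\<^sub>m n 1) D)"
proof -
  let ?N = "Suc n"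
  interpret V: vec_space "TYPE('a)" ?N .
  define b where "b = basis_completion v"
  note bc = V.basis_completion[OF v(1,2), folded b_def]
  define P where "P = mat_of_cols ?N b"
  have P: "P \<in> carrier_mat ?N ?N"
    unfolding P_def using bc(6) mat_of_cols_carrier(1)[of ?N b] by simp
  have "V.rank P = ?N"
    by (rule V.lin_indpt_full_rank[OF P])
      (use bc(2,4,5) in \<open>auto simp: P_def cols_mat_of_cols\<close>)
  then have "det P \<noteq> 0"
    using V.det_rank_iff[OF P] by simp
  from det_non_zero_imp_unit[OF P this, of "()"] obtain Q where
    Q: "Q \<in> carrier_mat ?N ?N" and QP: "Q * P = 1\<^sub>m ?N" and PQ: "P * Q = 1\<^sub>m ?N"
    unfolding Units_def by (auto simp: ring_mat_def)
  have b0: "b ! 0 = v" "length b = ?N"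
    using bc(6,7) hd_conv_nth[of b] by (cases b; simp)+
  have col0: "col P 0 = v"
    unfolding P_def using b0 v(1) bc(2) by (subst col_mat_of_cols) auto
  define B where "B = Q * (A * P)"
  have B: "B \<in> carrier_mat ?N ?N"
    unfolding B_def using Q A P by simp
  have "P * B * Q = (P * Q) * A * (P * Q)"
    unfolding B_def using P Q A by (simp add: assoc_mult_mat[of _ ?N ?N _ ?N _ ?N])
  then have "A = P * B * Q"
    unfolding PQ using A by simp
  then have simAB: "similar_mat A B"
    by (intro similar_matI[of _ _ P Q ?N]) (use A B P Q PQ QP in auto)
  have Qv: "Q *\<^sub>v v = unit_vec ?N 0"
  proof -
    have "Q *\<^sub>v v = col (Q * P) 0"
      using col0 P Q by (subst col_mult2[OF Q P]) auto
    then show ?thesis by (simp add: QP)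
  qed
  have "col B 0 = Q *\<^sub>v (A *\<^sub>v v)"
    using col_mult2[OF Q square_mult_carrier[OF A P], of 0] col_mult2[OF A P, of 0] col0
    by (simp add: B_def)
  also have "\<dots> = a \<cdot>\<^sub>v unit_vec ?N 0"
    unfolding v(3) using Qv mult_mat_vec[OF Q v(1)] by simp
  finally have colB: "col B 0 = a \<cdot>\<^sub>v unit_vec ?N 0" .
  have Bi0: "B $$ (i, 0) = (if i = 0 then a else 0)" if "i < ?N" for i
  proof -
    have "B $$ (i, 0) = col B 0 $ i" using B that by simp
    then show ?thesis unfolding colB using that by simp
  qed
  have "B = four_block_mat (a \<cdot>\<^sub>m 1\<^sub>m 1) (mat 1 n (\<lambda>(i, j). B $$ (i, Suc j)))
      (0\<^sub>m n 1) (mat n n (\<lambda>(i, j). B $$ (Suc i, Suc j)))"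
    by (rule eq_matI) (use B Bi0 in auto)
  with simAB show ?thesis
    by (intro exI[of _ "mat 1 n (\<lambda>(i, j). B $$ (i, Suc j))"]
        exI[of _ "mat n n (\<lambda>(i, j). B $$ (Suc i, Suc j))"]) auto
qed

context quadratic_field_char2
begin

text \<open>
  Eigenvectors for the eigenvalue $1$ are split off repeatedly until $1$ is no longer an eigenvalue of the
  remaining lower right block.
\<close>
lemma similar_split_eigenvalue_one:
  fixes A :: "'a mat"
  assumes "A \<in> carrier_mat n n"
  shows "\<exists>m k M. n = m + k \<and> M \<in> carrier_mat n n \<and> similar_mat A M \<and>
    (\<forall>i j. j < m \<longrightarrow> i < n \<longrightarrow> j \<le> i \<longrightarrow> M $$ (i, j) = (if i = j then 1 else 0)) \<and>
    det (1\<^sub>m k + mat k k (\<lambda>(i, j). M $$ (m + i, m + j))) \<noteq> 0"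
  using assms
proof (induction n arbitrary: A)
  case 0
  have "det (1\<^sub>m 0 + mat 0 0 (\<lambda>(i, j). A $$ (i, j))) \<noteq> 0"
    by (subst det_dim_zero) auto
  with 0 show ?case
    by (intro exI[of _ 0] exI[of _ A]) (auto intro: similar_mat_refl)
next
  case (Suc n)
  note A = Suc.prems
  show ?case
  proof (cases "det (1\<^sub>m (Suc n) + A) = 0")
    case False
    have "mat (Suc n) (Suc n) (\<lambda>(i, j). A $$ (i, j)) = A"
      using A by (intro eq_matI) auto
    with False A similar_mat_refl[OF A] show ?thesis
      by (intro exI[of _ 0] exI[of _ "Suc n"] exI[of _ A]) simp
  next
    case True
    then obtain v where v: "v \<in> carrier_vec (Suc n)" "v \<noteq> 0\<^sub>v (Suc n)"
      "(1\<^sub>m (Suc n) + A) *\<^sub>v v = 0\<^sub>v (Suc n)"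
      using det_0_iff_vec_prod_zero_field[of "1\<^sub>m (Suc n) + A" "Suc n"] A by auto
    have sum0: "v + A *\<^sub>v v = 0\<^sub>v (Suc n)"
      using v A by (simp add: add_mult_distrib_mat_vec[of _ "Suc n" "Suc n"])
    have "A *\<^sub>v v = 1 \<cdot>\<^sub>v v"
    proof (rule eq_vecI)
      fix i assume "i < dim_vec (1 \<cdot>\<^sub>v v)"
      then have i: "i < Suc n" using v by simp
      have "v $ i + (A *\<^sub>v v) $ i = 0"
        using arg_cong[OF sum0, of "\<lambda>w. vec_index w i"] i v A by simp
      then have "v $ i + (v $ i + (A *\<^sub>v v) $ i) = v $ i" by simp
      then show "(A *\<^sub>v v) $ i = (1 \<cdot>\<^sub>v v) $ i"
        using i v add_self[of "v $ i"] by (simp flip: add.assoc)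
    qed (use v A in auto)
    from similar_first_column_eigenvector[OF A v(1,2) this] obtain C D where
      CD: "C \<in> carrier_mat 1 n" "D \<in> carrier_mat n n"
      and sim: "similar_mat A (four_block_mat (1 \<cdot>\<^sub>m 1\<^sub>m 1) C (0\<^sub>m n 1) D)" by blast
    obtain m k M where n: "n = m + k" and M: "M \<in> carrier_mat n n" "similar_mat D M"
      and tri: "\<And>i j. \<lbrakk>j < m; i < n; j \<le> i\<rbrakk> \<Longrightarrow> M $$ (i, j) = (if i = j then 1 else 0)"
      and det: "det (1\<^sub>m k + mat k k (\<lambda>(i, j). M $$ (m + i, m + j))) \<noteq> 0"
      using Suc.IH[OF CD(2)] by blast
    have c1: "1 \<cdot>\<^sub>m 1\<^sub>m 1 \<in> carrier_mat 1 1" by simp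
    obtain C' where C': "C' \<in> carrier_mat 1 n"
      "similar_mat (four_block_mat (1 \<cdot>\<^sub>m 1\<^sub>m 1) C (0\<^sub>m n 1) D)
         (four_block_mat (1 \<cdot>\<^sub>m 1\<^sub>m 1) C' (0\<^sub>m n 1) M)"
      using similar_mat_four_block_0_ex[OF similar_mat_refl[OF c1] M(2) CD(1) c1 CD(2)] by blast
    define M' where "M' = four_block_mat (1 \<cdot>\<^sub>m 1\<^sub>m 1) C' (0\<^sub>m n 1) M"
    have M': "M' \<in> carrier_mat (Suc n) (Suc n)"
      unfolding M'_def using four_block_carrier_mat[OF c1 M(1)] by simp
    have "similar_mat A M'"
      unfolding M'_def by (rule similar_mat_trans[OF sim C'(2)])
    moreover have "M' $$ (i, j) = (if i = j then 1 else 0)" if "j < Suc m" "i < Suc n" "j \<le> i" for i j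
    proof (cases "j = 0")
      case True
      then show ?thesis using that M C' by (simp add: M'_def)
    next
      case False
      then have "M' $$ (i, j) = M $$ (i - 1, j - 1)"
        using that M C' n by (simp add: M'_def)
      also have "\<dots> = (if i - 1 = j - 1 then 1 else 0)"
        using tri[of "j - 1" "i - 1"] that False by simp
      finally show ?thesis using that False by auto
    qed
    moreover have "mat k k (\<lambda>(i, j). M' $$ (Suc m + i, Suc m + j)) = mat k k (\<lambda>(i, j). M $$ (m + i, m + j))"
      by (rule eq_matI) (use M C' n in \<open>simp_all add: M'_def\<close>)
    ultimately show ?thesis
      using M' det n by (intro exI[of _ "Suc m"] exI[of _ k] exI[of _ M']) auto
  qed
qed

text \<open>
  Unipotency is expressed by repeated squaring instead of powers because the equations below are
  preserved when all matrices in them are squared, in particular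
  $\det(1 + B^2) = \det(1 + B)^2$ in characteristic $2$.
\<close>
abbreviation iterated_square :: "nat \<Rightarrow> 'a mat \<Rightarrow> 'a mat" where
  "iterated_square r \<equiv> (\<lambda>M. M * M) ^^ r"

text \<open>
  In characteristic $2$ one has $(1 + N)^2 = 1 + N^2$, and squaring $N$ doubles the width of the band
  above the diagonal in which it is known to vanish.
\<close>
lemma iterated_square_unitriangular:
  assumes U: "U \<in> carrier_mat m m"
    and tri: "\<And>i j. \<lbrakk>i < m; j \<le> i\<rbrakk> \<Longrightarrow> U $$ (i, j) = (if i = j then 1 else 0)"
  shows "iterated_square m U = 1\<^sub>m m"
proof -
  have step: "iterated_square r U \<in> carrier_mat m m \<and>
    (\<forall>i j. i < m \<longrightarrow> j < m \<longrightarrow> j < i + 2 ^ r \<longrightarrow> iterated_square r U $$ (i, j) = (if i = j then 1 else 0))" for r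
  proof (induction r)
    case 0
    then show ?case using U tri by auto
  next
    case (Suc r)
    define S where "S = iterated_square r U"
    have S: "S \<in> carrier_mat m m"
      "\<And>i j. \<lbrakk>i < m; j < m; j < i + 2 ^ r\<rbrakk> \<Longrightarrow> S $$ (i, j) = (if i = j then 1 else 0)"
      using Suc by (auto simp: S_def)
    define N where "N = mat m m (\<lambda>(i, j). if i = j then 0 else S $$ (i, j))"
    have N: "N \<in> carrier_mat m m" by (simp add: N_def)
    have N0: "N $$ (i, j) = 0" if "i < m" "j < m" "j < i + 2 ^ r" for i j
      using that S(2)[of i j] by (simp add: N_def)
    have SN: "S = 1\<^sub>m m + N"
      by (rule eq_matI) (use S(1) S(2)[of _ _] in \<open>auto simp: N_def\<close>)
    have "S * S = 1\<^sub>m m + N * N"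
    proof -
      have "S * S = (1\<^sub>m m + N) + (N + N * N)"
        unfolding SN using N
        by (simp add: add_mult_distrib_mat[of _ m m _ _ m] mult_add_distrib_mat[of _ m m _ m])
      also have "\<dots> = 1\<^sub>m m + ((N + N) + N * N)"
        using N by (simp add: assoc_add_mat[of _ m m])
      also have "N + N = 0\<^sub>m m m" by (rule mat_add_self[OF N])
      finally show ?thesis using N by (simp add: left_add_zero_mat[of _ m m])
    qed
    moreover have "(N * N) $$ (i, j) = 0" if "i < m" "j < m" "j < i + 2 ^ Suc r" for i j
    proof -
      have "(N * N) $$ (i, j) = (\<Sum>l\<in>{0..<m}. N $$ (i, l) * N $$ (l, j))"
        using that N by (simp add: scalar_prod_def)
      also have "\<dots> = 0"
      proof (intro sum.neutral ballI)
        fix l assume "l \<in> {0..<m}"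
        then show "N $$ (i, l) * N $$ (l, j) = 0"
          using N0[of i l] N0[of l j] that by (cases "l < i + 2 ^ r") auto
      qed
      finally show ?thesis .
    qed
    ultimately show ?case
      using S(1) N by (auto simp: S_def[symmetric])
  qed
  have "j < i + 2 ^ m" if "j < m" for i j
    using that less_exp[of m] by linarith
  then show ?thesis
    using step[of m] by (intro eq_matI) auto
qed

lemma iterated_square_adj:
  "U \<in> carrier_mat m m \<Longrightarrow> iterated_square r U = 1\<^sub>m m \<Longrightarrow> iterated_square r (adj q U) = 1\<^sub>m m"
proof (induction r arbitrary: U)
  case (Suc r)
  have "iterated_square r (adj q (U * U)) = 1\<^sub>m m"
    using Suc.IH[of "U * U"] Suc.prems by (simp add: funpow_Suc_right del: funpow.simps)
  then show ?case
    using adj_mult[OF Suc.prems(1,1)] by (simp add: funpow_Suc_right del: funpow.simps)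
qed simp

lemma det_one_add_square:
  fixes B :: "'a mat"
  assumes B: "B \<in> carrier_mat k k" and det: "det (1\<^sub>m k + B) \<noteq> 0"
  shows "det (1\<^sub>m k + B * B) \<noteq> 0"
proof -
  have "(1\<^sub>m k + B) * (1\<^sub>m k + B) = (1\<^sub>m k + B) + (B + B * B)"
    using B by (simp add: add_mult_distrib_mat[of _ k k _ _ k] mult_add_distrib_mat[of _ k k _ k])
  also have "\<dots> = 1\<^sub>m k + ((B + B) + B * B)"
    using B by (simp add: assoc_add_mat[of _ k k])
  also have "B + B = 0\<^sub>m k k" by (rule mat_add_self[OF B])
  finally have "(1\<^sub>m k + B) * (1\<^sub>m k + B) = 1\<^sub>m k + B * B"
    using B by (simp add: left_add_zero_mat[of _ k k])
  then have "det (1\<^sub>m k + B * B) = det (1\<^sub>m k + B) * det (1\<^sub>m k + B)"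
    using det_mult[of "1\<^sub>m k + B" k "1\<^sub>m k + B"] B by simp
  then show ?thesis using det by simp
qed

lemma fixed_rows_zero:
  fixes B :: "'a mat"
  assumes B: "B \<in> carrier_mat k k" and det: "det (1\<^sub>m k + B) \<noteq> 0"
    and Z: "Z \<in> carrier_mat m k" "Z = Z * B"
  shows "Z = 0\<^sub>m m k"
proof -
  have c: "1\<^sub>m k + B \<in> carrier_mat k k" using B by simp
  obtain K where K: "K \<in> carrier_mat k k" "(1\<^sub>m k + B) * K = 1\<^sub>m k"
    using mat_inverse_exists[OF c det] by blast
  have "Z * (1\<^sub>m k + B) = Z + Z * B"
    using Z(1) B by (simp add: mult_add_distrib_mat[of _ m k _ k])
  also have "\<dots> = 0\<^sub>m m k"
    using Z mat_add_self by metis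
  finally have "Z * (1\<^sub>m k + B) * K = 0\<^sub>m m k" using K by simp
  then show ?thesis
    using assoc_mult_mat[OF Z(1) c K(1)] K Z by simp
qed

lemma unipotent_intertwiner_zero:
  fixes U B Z :: "'a mat"
  assumes "U \<in> carrier_mat m m" "B \<in> carrier_mat k k" "Z \<in> carrier_mat m k"
    and "iterated_square r U = 1\<^sub>m m" "det (1\<^sub>m k + B) \<noteq> 0" "U * Z = Z * B"
  shows "Z = 0\<^sub>m m k"
  using assms
proof (induction r arbitrary: U B)
  case 0
  then have "Z = Z * B" by simp
  with 0 show ?case using fixed_rows_zero by blast
next
  case (Suc r)
  note c = Suc.prems(1-3)
  have "U * U * Z = U * (Z * B)"
    using c Suc.prems(6) by (simp add: assoc_mult_mat[of _ m m _ m _ k])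
  also have "\<dots> = U * Z * B" using c by (simp add: assoc_mult_mat[of _ m m _ k _ k])
  also have "\<dots> = Z * (B * B)"
    unfolding Suc.prems(6) using c by (simp add: assoc_mult_mat[of _ m k _ k _ k])
  finally show ?case
    using Suc.IH[of "U * U" "B * B"] Suc.prems det_one_add_square
    by (simp add: funpow_Suc_right del: funpow.simps)
qed

text \<open>
  For $B$ without eigenvalue $1$, a form or a homomorphism between the two blocks that is invariant
  under $U$ and $B$ vanishes.
\<close>
lemma unipotent_cross_block_zero:
  fixes U B Z :: "'a mat"
  assumes "U \<in> carrier_mat m m" "B \<in> carrier_mat k k" "Z \<in> carrier_mat m k"
    and "iterated_square r U = 1\<^sub>m m" "det (1\<^sub>m k + B) \<noteq> 0" "Z = U * Z * B"
  shows "Z = 0\<^sub>m m k"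
  using assms
proof (induction r arbitrary: U B)
  case 0
  then have "Z = Z * B" by simp
  with 0 show ?case using fixed_rows_zero by blast
next
  case (Suc r)
  note c = Suc.prems(1-3)
  have "Z = U * (U * Z * B) * B"
    using Suc.prems(6) by metis
  also have "\<dots> = U * U * Z * (B * B)"
    using c mult_carrier_mat[OF c(1,3)] mult_carrier_mat[OF c(3,2)]
    by (simp add: assoc_mult_mat[of _ m m _ m _ k] assoc_mult_mat[of _ m m _ k _ k] assoc_mult_mat[of _ m k _ k _ k]
        mult_carrier_mat[of _ m m _ k] mult_carrier_mat[of _ m k _ k])
  finally show ?case
    using Suc.IH[of "U * U" "B * B"] Suc.prems det_one_add_square
    by (simp add: funpow_Suc_right del: funpow.simps)
qed

text \<open>
  The map $Z \mapsto UZ + ZB$ is additive with trivial kernel on a finite set, hence surjective.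
\<close>
lemma unipotent_sylvester_solvable:
  fixes B :: "'a mat"
  assumes U: "U \<in> carrier_mat m m" and B: "B \<in> carrier_mat k k" and Y: "Y \<in> carrier_mat m k"
    and unip: "iterated_square r U = 1\<^sub>m m" and det: "det (1\<^sub>m k + B) \<noteq> 0"
  shows "\<exists>Z\<in>carrier_mat m k. U * Z + Z * B = Y"
proof -
  let ?f = "\<lambda>Z. U * Z + Z * B"
  have cf: "?f Z \<in> carrier_mat m k" if "Z \<in> carrier_mat m k" for Z
    using mult_carrier_mat[OF U that] mult_carrier_mat[OF that B] by simp
  have "inj_on ?f (carrier_mat m k)"
  proof (rule inj_onI)
    fix Z W assume Z: "Z \<in> carrier_mat m k" and W: "W \<in> carrier_mat m k" and eq: "?f Z = ?f W"
    note c = mult_carrier_mat[OF U Z] mult_carrier_mat[OF U W] mult_carrier_mat[OF Z B] mult_carrier_mat[OF W B]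
    have "U * (Z + W) + (Z + W) * B = ?f Z + ?f W"
      using U B Z W c
      by (simp add: mult_add_distrib_mat[of _ m m _ k] add_mult_distrib_mat[of _ m k _ _ k])
        (intro eq_matI, auto simp: ac_simps)
    also have "\<dots> = 0\<^sub>m m k" unfolding eq by (rule mat_add_self[OF cf[OF W]])
    finally have 0: "U * (Z + W) + (Z + W) * B = 0\<^sub>m m k" .
    have ZW: "Z + W \<in> carrier_mat m k" using Z W by simp
    have two: "M = N" if "M + N = 0\<^sub>m m k" "M \<in> carrier_mat m k" "N \<in> carrier_mat m k" for M N :: "'a mat"
    proof -
      have "M = M + (N + N)" using that mat_add_self[OF that(3)] by simp
      also have "\<dots> = (M + N) + N" by (rule assoc_add_mat[OF that(2,3,3), symmetric])
      finally show ?thesis using that by simp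
    qed
    have "U * (Z + W) = (Z + W) * B"
      by (rule two[OF 0 mult_carrier_mat[OF U ZW] mult_carrier_mat[OF ZW B]])
    then have "Z + W = 0\<^sub>m m k"
      using unipotent_intertwiner_zero[OF U B ZW unip det] by simp
    then show "Z = W" using two Z W by blast
  qed
  moreover have "?f ` carrier_mat m k \<subseteq> carrier_mat m k" using cf by blast
  ultimately have "?f ` carrier_mat m k = carrier_mat m k"
    using endo_inj_surj[OF finite_carrier_mat] by blast
  then show ?thesis using Y by (metis (no_types, lifting) imageE)
qed

text \<open>
  The upper right block is removed by a unipotent change of basis whose corner solves a Sylvester
  equation.
\<close>
lemma similar_direct_sum_mat_unipotent:
  fixes A :: "'a mat"
  assumes A: "A \<in> carrier_mat n n"
  obtains m k U B where "n = m + k" "U \<in> carrier_mat m m" "B \<in> carrier_mat k k"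
    and "\<And>i j. \<lbrakk>i < m; j \<le> i\<rbrakk> \<Longrightarrow> U $$ (i, j) = (if i = j then 1 else 0)"
    and "det (1\<^sub>m k + B) \<noteq> 0" "similar_mat A (direct_sum_mat U B)"
proof -
  obtain m k M where n: "n = m + k" and M: "M \<in> carrier_mat n n" "similar_mat A M"
    and tri: "\<And>i j. \<lbrakk>j < m; i < n; j \<le> i\<rbrakk> \<Longrightarrow> M $$ (i, j) = (if i = j then 1 else 0)"
    and det: "det (1\<^sub>m k + mat k k (\<lambda>(i, j). M $$ (m + i, m + j))) \<noteq> 0"
    using similar_split_eigenvalue_one[OF A] by blast
  define U where "U = mat m m (\<lambda>(i, j). M $$ (i, j))"
  define Y where "Y = mat m k (\<lambda>(i, j). M $$ (i, m + j))"
  define B where "B = mat k k (\<lambda>(i, j). M $$ (m + i, m + j))"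
  have c: "U \<in> carrier_mat m m" "Y \<in> carrier_mat m k" "B \<in> carrier_mat k k"
    by (simp_all add: U_def Y_def B_def)
  have MUB: "M = four_block_mat U Y (0\<^sub>m k m) B"
    by (rule eq_matI) (use M n tri in \<open>auto simp: U_def Y_def B_def\<close>)
  have triU: "U $$ (i, j) = (if i = j then 1 else 0)" if "i < m" "j \<le> i" for i j
    using that tri[of j i] n by (simp add: U_def)
  obtain Z where Z: "Z \<in> carrier_mat m k" "U * Z + Z * B = Y"
    using unipotent_sylvester_solvable[OF c(1,3,2) iterated_square_unitriangular[OF c(1) triU]]
      det by (auto simp: B_def)
  let ?S = "four_block_mat (1\<^sub>m m) Z (0\<^sub>m k m) (1\<^sub>m k)"
  have S: "?S \<in> carrier_mat n n" unfolding n by (rule four_block_carrier_mat) auto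
  note cc = mult_carrier_mat[OF c(1) Z(1)] mult_carrier_mat[OF Z(1) c(3)]
  have SS: "?S * ?S = 1\<^sub>m n"
    using Z mat_add_self[OF Z(1)]
    by (simp add: n mult_four_block_mat[of _ m m _ k _ k _ _ m _ k])
  have UZ: "U * Z + Y = Z * B"
  proof -
    have "U * Z + (U * Z + Z * B) = (U * Z + U * Z) + Z * B"
      using cc by (simp add: assoc_add_mat[of _ m k])
    then show ?thesis using Z(2) mat_add_self[OF cc(1)] cc by simp
  qed
  have "M * ?S = four_block_mat U (Z * B) (0\<^sub>m k m) B"
    unfolding MUB using Z c UZ
    by (simp add: mult_four_block_mat[of _ m m _ k _ k _ _ m _ k])
  also have "\<dots> = ?S * direct_sum_mat U B"
    unfolding direct_sum_mat_eq[OF c(1,3)] using Z c cc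
    by (simp add: mult_four_block_mat[of _ m m _ k _ k _ _ m _ k])
  finally have MS: "M * ?S = ?S * direct_sum_mat U B" .
  have "M = M * (?S * ?S)" using M SS by simp
  also have "\<dots> = M * ?S * ?S" by (rule assoc_mult_mat[OF M(1) S S, symmetric])
  finally have "M = ?S * direct_sum_mat U B * ?S" unfolding MS .
  then have "similar_mat M (direct_sum_mat U B)"
    using M(1) S SS direct_sum_mat_carrier[OF c(1,3)] n by (intro similar_matI[of _ _ ?S ?S n]) auto
  from similar_mat_trans[OF M(2) this] show ?thesis
    using that[OF n c(1,3) triU] det by (simp add: B_def)
qed

lemma unitriangular_jordan_nf:
  fixes U :: "'a mat"
  assumes U: "U \<in> carrier_mat m m"
    and tri: "\<And>i j. \<lbrakk>i < m; j \<le> i\<rbrakk> \<Longrightarrow> U $$ (i, j) = (if i = j then 1 else 0)"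
  obtains ks where "0 \<notin> set ks" "similar_mat U (unipotent_jordan_matrix ks)" "sum_list ks = m"
proof -
  have up: "upper_triangular U" using U tri by auto
  define nas where "nas = triangular_to_jnf_vector U"
  have nf: "jordan_nf U nas"
    unfolding nas_def by (rule triangular_to_jnf_vector[OF U up])
  have "diag_mat U = replicate m 1"
    using U tri by (auto simp: diag_mat_def intro!: nth_equalityI)
  then have cp: "char_poly U = [:- 1, 1:] ^ m"
    using char_poly_upper_triangular[OF U up] by simp
  have "a = 1" if "(k, a) \<in> set nas" for k a
  proof -
    have "k \<noteq> 0" using nf that by (force simp: jordan_nf_def)
    then have "poly (\<Prod>(n, a)\<leftarrow>nas. [:- a, 1:] ^ n) a = 0"
      using that by (auto simp: poly_prod_list prod_list_zero_iff image_iff intro!: bexI[of _ "(k, a)"])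
    then have "poly ([:- 1, 1:] ^ m) a = 0"
      using jordan_nf_char_poly[OF nf] cp by simp
    then show ?thesis by (simp add: poly_power)
  qed
  then have "map (\<lambda>k. (k, 1)) (map fst nas) = nas"
    by (auto intro!: map_idI simp: o_def)
  then have "similar_mat U (unipotent_jordan_matrix (map fst nas))"
    using nf by (simp add: unipotent_jordan_matrix_def jordan_nf_def)
  moreover have "0 \<notin> set (map fst nas)" using nf by (simp add: jordan_nf_def)
  moreover have "sum_list (map fst nas) = m"
  proof -
    obtain l P Q where "{U, unipotent_jordan_matrix (map fst nas), P, Q} \<subseteq> carrier_mat l l"
      using similar_matD[OF \<open>similar_mat U (unipotent_jordan_matrix (map fst nas))\<close>] by blast
    then show ?thesis using U unipotent_jordan_matrix_carrier[of "map fst nas"]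
      by (metis carrier_matD(1) insert_subset)
  qed
  ultimately show ?thesis using that by blast
qed

interpretation to_ac: comm_ring_hom "to_ac :: 'a \<Rightarrow> 'a alg_closure"
  by unfold_locales auto

text \<open>
  Over the algebraic closure $B$ still does not have the eigenvalue $1$, so that all Jordan blocks with
  this eigenvalue come from the unipotent summand.
\<close>
lemma elementary_divisor_mult_unipotent:
  fixes B :: "'a mat"
  assumes sim: "similar_mat A (direct_sum_mat (unipotent_jordan_matrix ks) B)" and ks: "0 \<notin> set ks"
    and B: "B \<in> carrier_mat k k" "det (1\<^sub>m k + B) \<noteq> 0"
  shows "elementary_divisor_mult A 1 j = count_list ks j"
proof -
  let ?h = "map_mat (to_ac :: 'a \<Rightarrow> 'a alg_closure)"
  define J :: "'a mat" where "J = unipotent_jordan_matrix ks"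
  have J: "J \<in> carrier_mat (sum_list ks) (sum_list ks)" by (simp add: J_def)
  have hB: "?h B \<in> carrier_mat k k" using B by simp
  obtain ms where ms: "jordan_nf (?h B) ms"
    using jordan_nf_exists_alg_closed[OF hB] by blast
  have no1: "(j, 1) \<notin> set ms"
  proof
    assume mem: "(j, 1) \<in> set ms"
    have "j \<noteq> 0" using ms mem by (force simp: jordan_nf_def)
    then have "poly (\<Prod>(n, a)\<leftarrow>ms. [:- a, 1:] ^ n) 1 = 0"
      using mem by (auto simp: poly_prod_list prod_list_zero_iff image_iff intro!: bexI[of _ "(j, 1)"])
    then have "eigenvalue (?h B) 1"
      using eigenvalue_root_char_poly[OF hB] jordan_nf_char_poly[OF ms] by simp
    then have "det (char_matrix (?h B) 1) = 0"
      using eigenvalue_det[OF hB] by simp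
    moreover have "char_matrix (?h B) 1 = ?h (1\<^sub>m k + B)"
    proof (rule eq_matI)
      have m1: "(- 1 :: 'a) = 1" using uminus_CHAR_2[OF char_2] by blast
      have "- (1 :: 'a alg_closure) = to_ac (- 1)" by simp
      then have m1': "- (1 :: 'a alg_closure) = 1" unfolding m1 by simp
      fix i j assume "i < dim_row (?h (1\<^sub>m k + B))" "j < dim_col (?h (1\<^sub>m k + B))"
      then show "char_matrix (?h B) 1 $$ (i, j) = ?h (1\<^sub>m k + B) $$ (i, j)"
        using B(1) m1' by (auto simp: char_matrix_def)
    qed (use B in \<open>auto simp: char_matrix_def\<close>)
    ultimately have "to_ac (det (1\<^sub>m k + B)) = (0 :: 'a alg_closure)"
      using to_ac.hom_det[of "1\<^sub>m k + B"] by simp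
    then show False using B(2) by simp
  qed
  have "similar_mat (?h A) (?h (direct_sum_mat J B))"
  proof -
    obtain l P Q where l: "{A, direct_sum_mat J B, P, Q} \<subseteq> carrier_mat l l" "P * Q = 1\<^sub>m l" "Q * P = 1\<^sub>m l"
      "A = P * direct_sum_mat J B * Q"
      using similar_matD[OF sim] unfolding J_def by blast
    have c: "P \<in> carrier_mat l l" "Q \<in> carrier_mat l l" "direct_sum_mat J B \<in> carrier_mat l l" using l by auto
    have "?h P * ?h Q = 1\<^sub>m l" "?h Q * ?h P = 1\<^sub>m l"
      using to_ac.mat_hom_mult[OF c(1,2)] to_ac.mat_hom_mult[OF c(2,1)] l by (simp_all add: to_ac.mat_hom_one)
    moreover have "?h A = ?h P * ?h (direct_sum_mat J B) * ?h Q"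
      unfolding l(4) using c
      by (simp add: to_ac.mat_hom_mult[of _ l l _ l])
    ultimately show ?thesis
      using c l by (intro similar_matI[of _ _ "?h P" "?h Q" l]) auto
  qed
  moreover have "?h (direct_sum_mat J B) = direct_sum_mat (unipotent_jordan_matrix ks) (?h B)"
  proof -
    have "?h (unipotent_jordan_matrix ls) = unipotent_jordan_matrix ls" for ls
    proof (induction ls)
      case Nil
      then show ?case
        by (intro eq_matI) (simp_all add: unipotent_jordan_matrix_def jordan_matrix_def)
    next
      case (Cons l ls)
      have hd: "?h (direct_sum_mat M N) = direct_sum_mat (?h M) (?h N)" for M N
        by (rule eq_matI) (auto simp: direct_sum_mat_def)
      have "?h (jordan_block l 1) = jordan_block l 1"
        by (rule eq_matI) auto
      then show ?case
        using unipotent_jordan_matrix_append[of "[l]" ls, where 'a = 'a]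
          unipotent_jordan_matrix_append[of "[l]" ls, where 'a = "'a alg_closure"] Cons
        by (simp add: hd unipotent_jordan_matrix_single)
    qed
    moreover have "?h (direct_sum_mat J B) = direct_sum_mat (?h J) (?h B)"
      by (rule eq_matI) (auto simp: direct_sum_mat_def)
    ultimately show ?thesis by (simp add: J_def)
  qed
  moreover have "similar_mat (direct_sum_mat (unipotent_jordan_matrix ks) (?h B))
      (jordan_matrix (map (\<lambda>k. (k, 1)) ks @ ms))"
    unfolding jordan_matrix_append
    using ms by (intro similar_mat_direct_sum_mat)
      (auto simp: jordan_nf_def unipotent_jordan_matrix_def intro!: similar_mat_refl[OF jordan_matrix_carrier])
  ultimately have "similar_mat (?h A) (jordan_matrix (map (\<lambda>k. (k, 1)) ks @ ms))"
    by (metis similar_mat_trans)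
  then have "jordan_nf (?h A) (map (\<lambda>k. (k, 1)) ks @ ms)"
    using ks ms by (auto simp: jordan_nf_def)
  then have "elementary_divisor_mult A 1 j = count_list (map (\<lambda>k. (k, 1)) ks @ ms) (j, to_ac 1)"
    by (rule elementary_divisor_mult_eq)
  also have "\<dots> = count_list (map (\<lambda>k. (k, 1 :: 'a alg_closure)) ks) (j, 1)"
    using no1 count_notin[of "(j, 1)" ms] by simp
  also have "\<dots> = count_list ks j"
    by (induction ks) auto
  finally show ?thesis .
qed

section \<open>Real elements of the unitary group\<close>

text \<open>
  In a basis in which $g$ is the direct sum of a unipotent block and a block without eigenvalue $1$, the
  off-diagonal blocks of the form and of the conjugating element are zero. So the second
  block is again real for a non-degenerate hermitian form, while the first one is covered by the models for
  Jordan blocks.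
\<close>
lemma real_imp_strongly_real:
  fixes g x :: "'a mat"
  assumes g: "g \<in> carrier_mat n n" "adj q g * g = 1\<^sub>m n"
    and x: "x \<in> carrier_mat n n" "adj q x * x = 1\<^sub>m n" and gxg: "g * x * g = x"
    and mult: "(\<forall>m\<ge>1. even (elementary_divisor_mult g 1 (2 * m + 1))) \<or>
         (elementary_divisor_mult g 1 1 > 0 \<and>
          (\<forall>m\<ge>2. even (elementary_divisor_mult g 1 (2 * m + 1))))"
  obtains s where "s \<in> carrier_mat n n" "s * s = 1\<^sub>m n" "adj q s * s = 1\<^sub>m n" "s * g * s * g = 1\<^sub>m n"
proof -
  obtain m k U B where n: "n = m + k" and U: "U \<in> carrier_mat m m" and B: "B \<in> carrier_mat k k"
    and tri: "\<And>i j. \<lbrakk>i < m; j \<le> i\<rbrakk> \<Longrightarrow> U $$ (i, j) = (if i = j then 1 else 0)"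
    and det: "det (1\<^sub>m k + B) \<noteq> 0" and sim: "similar_mat g (direct_sum_mat U B)"
    using similar_direct_sum_mat_unipotent[OF g(1)] by blast
  obtain ks where ks: "0 \<notin> set ks" "similar_mat U (unipotent_jordan_matrix ks)" "sum_list ks = m"
    using unitriangular_jordan_nf[OF U tri] by blast
  have simJ: "similar_mat g (direct_sum_mat (unipotent_jordan_matrix ks) B)"
    using similar_mat_trans[OF sim similar_mat_direct_sum_mat[OF ks(2) similar_mat_refl[OF B]]] .
  have "elementary_divisor_mult g 1 j = count_list ks j" for j
    by (rule elementary_divisor_mult_unipotent[OF simJ ks(1) B det])
  then have good1: "isometric_involution_product m (unipotent_jordan_matrix ks)"
    using isometric_involution_product_unipotent[of ks] mult ks(3) by simp
  define D where "D = direct_sum_mat U B"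
  have D: "D \<in> carrier_mat n n" using direct_sum_mat_carrier[OF U B] by (simp add: D_def n)
  obtain P Q where P: "P \<in> carrier_mat n n" and Q: "Q \<in> carrier_mat n n"
    and PQ: "P * Q = 1\<^sub>m n" "Q * P = 1\<^sub>m n" and gD: "g = P * D * Q"
  proof -
    obtain l P Q where l: "{g, D, P, Q} \<subseteq> carrier_mat l l" "P * Q = 1\<^sub>m l" "Q * P = 1\<^sub>m l" "g = P * D * Q"
      using similar_matD[OF sim[folded D_def]] by blast
    then have "l = n" using g(1) by auto
    with l that show ?thesis by auto
  qed
  note assoc = assoc_mult_mat[of _ n n _ n _ n]
  have PQx: "P * (Q * M) = M" "Q * (P * M) = M" if "M \<in> carrier_mat n n" for M
    using that P Q PQ by (simp_all flip: assoc)
  have aPQ: "adj q Q * adj q P = 1\<^sub>m n" "adj q P * adj q Q = 1\<^sub>m n"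
    using PQ by (simp_all flip: adj_mult[OF P Q] adj_mult[OF Q P])
  have sPQ: "adj q Q * (adj q P * M) = M" "adj q P * (adj q Q * M) = M"
    if "M \<in> carrier_mat n n" for M
    using that P Q aPQ by (simp_all flip: assoc)
  (* The standard form and the element x in the basis given by the columns of P. *)
  define H where "H = adj q P * P"
  have H: "H \<in> carrier_mat n n" using P by (simp add: H_def)
  have sH: "adj q H = H" unfolding H_def using P by (simp add: adj_mult[of _ n n _ n])
  have detP: "det P \<noteq> 0" using mat_det_nonzero[OF P Q PQ(2)] .
  have detaP: "det (adj q P) \<noteq> 0"
    by (rule mat_det_nonzero[OF adj_carrier[OF P] adj_carrier[OF Q] aPQ(1)])
  have detH: "det H \<noteq> 0"
    using det_mult[of "adj q P" n P] P detP detaP by (simp add: H_def)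
  have iso: "adj q (Q * y * P) * H * (Q * y * P) = H"
    if y: "y \<in> carrier_mat n n" "adj q y * y = 1\<^sub>m n" for y
  proof -
    have "adj q (Q * y * P) * H * (Q * y * P) = adj q P * (adj q y * y) * P"
      unfolding H_def using P Q y(1) PQx sPQ by (simp add: adj_mult[of _ n n _ n] assoc)
    then show ?thesis using P y(2) by (simp add: H_def)
  qed
  have DQ: "D = Q * g * P"
    unfolding gD using P Q D PQ PQx by (simp add: assoc)
  have isoD: "adj q D * H * D = H" unfolding DQ by (rule iso[OF g])
  define z where "z = Q * x * P"
  have z: "z \<in> carrier_mat n n" using P Q x by (simp add: z_def)
  have isoz: "adj q z * H * z = H" unfolding z_def by (rule iso[OF x])
  have DzD: "D * z * D = z"
  proof -
    have "D * z * D = Q * (g * x * g) * P"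
      unfolding DQ z_def using P Q x(1) g(1) PQx by (simp add: assoc)
    then show ?thesis unfolding gxg z_def .
  qed
  note unip = iterated_square_unitriangular[OF U tri]
  have aU: "adj q U \<in> carrier_mat m m" and aB: "adj q B \<in> carrier_mat k k" using U B by auto
  have blocks: "\<exists>A1 A2 A3 A4. A1 \<in> carrier_mat m m \<and> A2 \<in> carrier_mat m k \<and> A3 \<in> carrier_mat k m
      \<and> A4 \<in> carrier_mat k k \<and> A = four_block_mat A1 A2 A3 A4"
    if A: "A \<in> carrier_mat n n" for A
  proof -
    obtain A1 A2 A3 A4 where sp: "split_block A m m = (A1, A2, A3, A4)"
      by (cases "split_block A m m") auto
    from split_block[OF sp, of k k] A n show ?thesis by auto
  qed
  have blocks_eq: "A2 = B2 \<and> A3 = B3 \<and> A4 = B4"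
    if "four_block_mat A1 A2 A3 A4 = four_block_mat B1 B2 B3 B4"
      "A1 \<in> carrier_mat m m" "A2 \<in> carrier_mat m k" "A3 \<in> carrier_mat k m" "A4 \<in> carrier_mat k k"
      "B1 \<in> carrier_mat m m" "B2 \<in> carrier_mat m k" "B3 \<in> carrier_mat k m" "B4 \<in> carrier_mat k k"
    for A1 A2 A3 A4 B1 B2 B3 B4 :: "'a mat"
  proof -
    have e: "four_block_mat A1 A2 A3 A4 $$ ij = four_block_mat B1 B2 B3 B4 $$ ij" for ij
      using that(1) by simp
    have "A2 = B2"
    proof (rule eq_matI)
      fix i j assume "i < dim_row B2" "j < dim_col B2"
      then show "A2 $$ (i, j) = B2 $$ (i, j)" using e[of "(i, m + j)"] that(2-) by simp
    qed (use that(2-) in simp_all)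
    moreover have "A3 = B3"
    proof (rule eq_matI)
      fix i j assume "i < dim_row B3" "j < dim_col B3"
      then show "A3 $$ (i, j) = B3 $$ (i, j)" using e[of "(m + i, j)"] that(2-) by simp
    qed (use that(2-) in simp_all)
    moreover have "A4 = B4"
    proof (rule eq_matI)
      fix i j assume "i < dim_row B4" "j < dim_col B4"
      then show "A4 $$ (i, j) = B4 $$ (i, j)" using e[of "(m + i, m + j)"] that(2-) by simp
    qed (use that(2-) in simp_all)
    ultimately show ?thesis by simp
  qed
  have mult_diag: "direct_sum_mat A' B' * four_block_mat A1 A2 A3 A4 * direct_sum_mat A'' B''
      = four_block_mat (A' * A1 * A'') (A' * A2 * B'') (B' * A3 * A'') (B' * A4 * B'')"
    if "A' \<in> carrier_mat m m" "B' \<in> carrier_mat k k" "A'' \<in> carrier_mat m m" "B'' \<in> carrier_mat k k"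
      "A1 \<in> carrier_mat m m" "A2 \<in> carrier_mat m k" "A3 \<in> carrier_mat k m" "A4 \<in> carrier_mat k k"
    for A' B' A'' B'' A1 A2 A3 A4 :: "'a mat"
    using that mult_carrier_mat[OF that(1,6)] mult_carrier_mat[OF that(2,7)]
      mult_carrier_mat[OF mult_carrier_mat[OF that(1,6)] that(4)]
      mult_carrier_mat[OF mult_carrier_mat[OF that(2,7)] that(3)]
    by (simp add: direct_sum_mat_eq[of _ m _ k] mult_four_block_mat[of _ m m _ k _ k _ _ m _ k])
  have adjD: "adj q D = direct_sum_mat (adj q U) (adj q B)"
    unfolding D_def direct_sum_mat_eq[OF U B] direct_sum_mat_eq[OF aU aB]
    by (subst adj_four_block[OF U zero_carrier_mat zero_carrier_mat B]) simp
  obtain H1 H2 H3 H4 where Hc: "H1 \<in> carrier_mat m m" "H2 \<in> carrier_mat m k" "H3 \<in> carrier_mat k m"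
    "H4 \<in> carrier_mat k k" and HH: "H = four_block_mat H1 H2 H3 H4"
    using blocks[OF H] by blast
  have "four_block_mat (adj q U * H1 * U) (adj q U * H2 * B) (adj q B * H3 * U) (adj q B * H4 * B)
      = four_block_mat H1 H2 H3 H4"
    using isoD[unfolded adjD, unfolded HH D_def] mult_diag[OF aU aB U B Hc] by simp
  note eqH = blocks_eq[OF this square_mult_carrier[OF square_mult_carrier[OF aU Hc(1)] U]
      mult_carrier_mat[OF mult_carrier_mat[OF aU Hc(2)] B]
      mult_carrier_mat[OF mult_carrier_mat[OF aB Hc(3)] U]
      square_mult_carrier[OF square_mult_carrier[OF aB Hc(4)] B] Hc]
  have eqH: "adj q U * H2 * B = H2" "adj q B * H4 * B = H4"
    using eqH by blast+
  have H2: "H2 = 0\<^sub>m m k"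
    by (rule unipotent_cross_block_zero[OF aU B Hc(2) iterated_square_adj[OF U unip] det eqH(1)[symmetric]])
  have "four_block_mat (adj q H1) (adj q H3) (adj q H2) (adj q H4) = four_block_mat H1 H2 H3 H4"
    using sH adj_four_block[OF Hc] by (simp add: HH)
  note sH' = blocks_eq[OF this _ _ _ _ Hc]
  have sH': "adj q H2 = H3" "adj q H4 = H4"
    using sH' Hc by simp_all
  have H3: "H3 = 0\<^sub>m k m" using sH'(1) H2 by simp
  have Hd: "H = direct_sum_mat H1 H4" by (simp add: HH H2 H3 direct_sum_mat_eq[OF Hc(1,4)])
  have formH4: "hermitian_form k H4"
    using detH det_direct_sum_mat[OF Hc(1,4)] Hc(4) sH'(2) by (simp add: hermitian_form_def Hd)
  have isoB: "isometry H4 B" using eqH(2) by (simp add: isometry_def)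
  obtain z1 z2 z3 z4 where zc: "z1 \<in> carrier_mat m m" "z2 \<in> carrier_mat m k" "z3 \<in> carrier_mat k m"
    "z4 \<in> carrier_mat k k" and zz: "z = four_block_mat z1 z2 z3 z4"
    using blocks[OF z] by blast
  have "four_block_mat (U * z1 * U) (U * z2 * B) (B * z3 * U) (B * z4 * B) = four_block_mat z1 z2 z3 z4"
    using DzD[unfolded zz D_def] mult_diag[OF U B U B zc] by simp
  note eqz = blocks_eq[OF this square_mult_carrier[OF square_mult_carrier[OF U zc(1)] U]
      mult_carrier_mat[OF mult_carrier_mat[OF U zc(2)] B]
      mult_carrier_mat[OF mult_carrier_mat[OF B zc(3)] U]
      square_mult_carrier[OF square_mult_carrier[OF B zc(4)] B] zc]
  have eqz: "U * z2 * B = z2" "B * z3 * U = z3" "B * z4 * B = z4"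
    using eqz by blast+
  have z2: "z2 = 0\<^sub>m m k"
    by (rule unipotent_cross_block_zero[OF U B zc(2) unip det eqz(1)[symmetric]])
  have z3: "z3 = 0\<^sub>m k m"
  proof -
    have oneB: "1\<^sub>m k + B \<in> carrier_mat k k" using B by simp
    obtain K where K: "K \<in> carrier_mat k k" "(1\<^sub>m k + B) * K = 1\<^sub>m k"
      using mat_inverse_exists[OF oneB det] by blast
    have "adj q K * adj q (1\<^sub>m k + B) = 1\<^sub>m k"
      using adj_mult[OF oneB K(1)] K(2) by simp
    then have "det (adj q (1\<^sub>m k + B)) \<noteq> 0"
      by (rule mat_det_nonzero[OF adj_carrier[OF oneB] adj_carrier[OF K(1)]])
    then have deta: "det (1\<^sub>m k + adj q B) \<noteq> 0"
      using adj_add[OF one_carrier_mat B] by simp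
    have "adj q z3 = adj q (B * z3 * U)" using eqz(2) by simp
    also have "\<dots> = adj q U * (adj q z3 * adj q B)"
      by (simp add: adj_mult[OF mult_carrier_mat[OF B zc(3)] U] adj_mult[OF B zc(3)])
    also have "\<dots> = adj q U * adj q z3 * adj q B"
      by (rule assoc_mult_mat[OF aU adj_carrier[OF zc(3)] aB, symmetric])
    finally have fixed: "adj q z3 = adj q U * adj q z3 * adj q B" .
    have "adj q z3 = 0\<^sub>m m k"
      by (rule unipotent_cross_block_zero[OF aU aB adj_carrier[OF zc(3)] iterated_square_adj[OF U unip] deta fixed])
    then have "adj q (adj q z3) = 0\<^sub>m k m" by simp
    then show ?thesis by simp
  qed
  have adjz: "adj q z = direct_sum_mat (adj q z1) (adj q z4)"
    using adj_four_block[OF zc] zc by (simp add: zz z2 z3 direct_sum_mat_eq[of _ m _ k])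
  have "four_block_mat (adj q z1 * H1 * z1) (adj q z1 * H2 * z4) (adj q z4 * H3 * z1) (adj q z4 * H4 * z4)
      = four_block_mat H1 H2 H3 H4"
  proof -
    have zd: "z = direct_sum_mat z1 z4" by (simp add: zz z2 z3 direct_sum_mat_eq[OF zc(1,4)])
    show ?thesis
      using isoz[unfolded adjz, unfolded HH zd]
        mult_diag[OF adj_carrier[OF zc(1)] adj_carrier[OF zc(4)] zc(1,4) Hc]
      by simp
  qed
  note isoz4 = blocks_eq[OF this
      square_mult_carrier[OF square_mult_carrier[OF adj_carrier[OF zc(1)] Hc(1)] zc(1)]
      mult_carrier_mat[OF mult_carrier_mat[OF adj_carrier[OF zc(1)] Hc(2)] zc(4)]
      mult_carrier_mat[OF mult_carrier_mat[OF adj_carrier[OF zc(4)] Hc(3)] zc(1)]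
      square_mult_carrier[OF square_mult_carrier[OF adj_carrier[OF zc(4)] Hc(4)] zc(4)] Hc]
  have "adj q z4 * H4 * z4 = H4"
    using isoz4 by blast
  then have "isometry H4 z4" by (simp add: isometry_def)
  from isometric_involution_product_of_real[OF formH4 B isoB zc(4) this eqz(3) det]
  have "isometric_involution_product k B" .
  from isometric_involution_product_direct_sum_mat[OF good1 this]
  have "isometric_involution_product n (direct_sum_mat (unipotent_jordan_matrix ks) B)" by (simp add: n)
  from isometric_involution_product_similar[OF simJ this]
  have "isometric_involution_product n g" .
  from isometric_involution_product_strongly_real[OF this g(2)] that show ?thesis by blast
qed

end

theorem proposition6p2:
  fixes q e n :: nat and g :: "'a :: finite_field mat"
  assumes "q = 2 ^ e" and "e \<ge> 1"
    and "CARD('a) = q\<^sup>2"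
    and "n \<ge> 1"
    and "real_element (unitary_group TYPE('a) n q) g"
    and "(\<forall>m\<ge>1. even (elementary_divisor_mult g 1 (2 * m + 1))) \<or>
         (elementary_divisor_mult g 1 1 > 0 \<and>
          (\<forall>m\<ge>2. even (elementary_divisor_mult g 1 (2 * m + 1))))"
  shows "strongly_real_element (unitary_group TYPE('a) n q) g"
proof -
  let ?G = "unitary_group TYPE('a) n q"
  interpret quadratic_field_char2 q e "TYPE('a)"
    by unfold_locales (use assms(1-3) in auto)
  interpret G: group ?G
    by (rule group_unitary_group[OF two_is_prime_nat assms(1,3)])
  have carrier: "y \<in> carrier ?G \<longleftrightarrow> y \<in> carrier_mat n n \<and> invertible_mat y \<and> adj q y * y = 1\<^sub>m n" for y
    by (simp add: unitary_group_def adj_def)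
  have mult: "y \<otimes>\<^bsub>?G\<^esub> z = y * z" for y z by (simp add: unitary_group_def)
  have one: "\<one>\<^bsub>?G\<^esub> = 1\<^sub>m n" by (simp add: unitary_group_def)
  obtain x where g: "g \<in> carrier ?G" and x: "x \<in> carrier ?G"
    and conj: "x \<otimes>\<^bsub>?G\<^esub> g \<otimes>\<^bsub>?G\<^esub> inv\<^bsub>?G\<^esub> x = inv\<^bsub>?G\<^esub> g"
    using assms(5) unfolding real_element_def by blast
  have "x \<otimes>\<^bsub>?G\<^esub> g = inv\<^bsub>?G\<^esub> g \<otimes>\<^bsub>?G\<^esub> x"
    using conj g x by (metis G.inv_closed G.m_closed G.inv_solve_right)
  then have "g \<otimes>\<^bsub>?G\<^esub> (x \<otimes>\<^bsub>?G\<^esub> g) = x"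
    using g x by (metis G.inv_closed G.l_one G.m_assoc G.r_inv)
  then have gxg: "g * x * g = x"
    using g x by (simp add: mult carrier assoc_mult_mat[of g n n x n g n])
  obtain s where s: "s \<in> carrier_mat n n" "s * s = 1\<^sub>m n" "adj q s * s = 1\<^sub>m n" "s * g * s * g = 1\<^sub>m n"
    using real_imp_strongly_real[OF _ _ _ _ gxg assms(6)] g x carrier by blast
  have "invertible_mat s"
    unfolding invertible_mat_def inverts_mat_def using s by auto
  then have sG: "s \<in> carrier ?G" using s carrier by blast
  have "s \<otimes>\<^bsub>?G\<^esub> g \<otimes>\<^bsub>?G\<^esub> s \<in> carrier ?G"
    using sG g by simp
  then have "s \<otimes>\<^bsub>?G\<^esub> g \<otimes>\<^bsub>?G\<^esub> s = inv\<^bsub>?G\<^esub> g"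
    using s(4) g by (intro G.inv_equality[symmetric]) (simp_all add: mult one)
  then show ?thesis
    unfolding strongly_real_element_def using g sG s(2) by (auto simp: mult one)
qed

end
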